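(* Let $\mathcal{X}\subset\mathbb{R}^d$ be compact, let $k$ be a stationary kernel that is sufficiently regular for $f\sim\mathcal{GP}(\mu,k)$ to be almost surely continuous on $\mathcal{X}$, and let $\tilde f(\cdot)=\sum_{i=1}^{\ell}w_i\phi_i(\cdot)$ be an approximate prior with continuous basis functions $\phi_i:\mathcal{X}\to\mathbb{R}$ and Gaussian weights $w\sim\mathcal{N}(0,\Sigma_w)$. Let $X_n\subset\mathcal{X}$ be a set of $n$ points such that $K_{n,n}=k(X_n,X_n)$ is invertible, let $y\in\mathbb{R}^n$, and define the processes $$(f\mid y)(\cdot)=f(\cdot)+k(\cdot,X_n)K_{n,n}^{-1}(y-f(X_n)),\qquad (\tilde f\mid y)(\cdot)=\tilde f(\cdot)+k(\cdot,X_n)K_{n,n}^{-1}(y-\tilde f(X_n)).$$ Set $$C_1=\sqrt{2}\,\operatorname{diam}(\mathcal{X})^{d/2}\Bigl(1+\|k\|_{\mathcal{C}(\mathcal{X}^2)}^2\,\|K_{n,n}^{-1}\|_{L(\ell^\infty;\ell^1)}^2\Bigr)^{1/2}.$$ Then $$W_{2,L^2(\mathcal{X})}\bigl(\tilde f\mid y,\; f\mid y\bigr)\;\le\; C_1\,W_{2,\mathcal{C}(\mathcal{X})}\bigl(\tilde f,f\bigr).$$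
   Context: A kernel $k$ is stationary if $k(x,x')$ depends only on $x-x'$. For a finite set of points $X_n=(x_1,\dots,x_n)$, $k(\cdot,X_n)$ is the row vector $(k(\cdot,x_1),\dots,k(\cdot,x_n))$, $k(X_n,X_n)$ is the $n\times n$ matrix with entries $k(x_i,x_j)$, and $f(X_n)=(f(x_1),\dots,f(x_n))^\top$. The process $f\mid y$ is (in distribution) the Gaussian process $f$ conditioned on the noise-free observations $f(X_n)=y$; $\tilde f\mid y$ applies the same update, built from the true kernel $k$, to the approximate prior. For a normed function space $E$ (here $E=L^2(\mathcal{X})$ with Lebesgue measure, or $E=\mathcal{C}(\mathcal{X})$, the continuous functions with the supremum norm) and processes $g,h$ with paths in $E$, the 2-Wasserstein distance is $W_{2,E}(g,h)=\bigl(\inf_{\pi}\mathbb{E}_{(g',h')\sim\pi}\|g'-h'\|_E^2\bigr)^{1/2}$, where the infimum is over all couplings $\pi$ of the laws of $g$ and $h$ on $E$. $\|k\|_{\mathcal{C}(\mathcal{X}^2)}=\sup_{x,x'\in\mathcal{X}}|k(x,x')|$, and $\|A\|_{L(\ell^\infty;\ell^1)}=\sup_{\|v\|_\infty\le 1}\|Av\|_1$ for an $n\times n$ matrix $A$. *)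

theory Defs
  imports "HOL-Probability.Probability"
begin

section \<open>The spaces \<open>C(X)\<close> and \<open>L\<^sup>2\<close> as metric spaces\<close>

text \<open>For compact \<open>X\<close> the boundedness condition in \<^const>\<open>cfunspace\<close> is automatic. Its
  elements are the functions that are continuous on \<open>X\<close> and \<^const>\<open>undefined\<close> off \<open>X\<close>.\<close>

definition C_space :: "'a::topological_space set \<Rightarrow> ('a \<Rightarrow> real) metric" where
  "C_space X = cfunspace (top_of_set X) euclidean_metric"

definition square_integrable :: "'a measure \<Rightarrow> ('a \<Rightarrow> real) set" where
  "square_integrable M = {g \<in> borel_measurable M. integrable M (\<lambda>x. (g x)\<^sup>2)}"

text \<open>Points of \<open>L\<^sup>2\<close> are genuine equivalence classes. The class of a function that is not almost
  everywhere equal to a square integrable one is empty, hence not a point of \<open>L\<^sup>2\<close>.\<close>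

definition L2_class :: "'a measure \<Rightarrow> ('a \<Rightarrow> real) \<Rightarrow> ('a \<Rightarrow> real) set" where
  "L2_class M g = {h \<in> square_integrable M. AE x in M. h x = g x}"

definition L2_dist :: "'a measure \<Rightarrow> ('a \<Rightarrow> real) set \<Rightarrow> ('a \<Rightarrow> real) set \<Rightarrow> real" where
  "L2_dist M G H =
     sqrt (integral\<^sup>L M (\<lambda>x. ((SOME g. g \<in> G) x - (SOME h. h \<in> H) x)\<^sup>2))"

definition L2_metric :: "'a measure \<Rightarrow> ('a \<Rightarrow> real) set metric" where
  "L2_metric M = metric (L2_class M ` square_integrable M, L2_dist M)"

abbreviation L2_space :: "'a::euclidean_space set \<Rightarrow> ('a \<Rightarrow> real) set metric" where
  "L2_space X \<equiv> L2_metric (lebesgue_on X)"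

lemma square_integrable_mult:
  assumes "g \<in> square_integrable M" "h \<in> square_integrable M"
  shows "integrable M (\<lambda>x. g x * h x)"
proof (rule Bochner_Integration.integrable_bound[where f = "\<lambda>x. (g x)\<^sup>2 + (h x)\<^sup>2"])
  show "integrable M (\<lambda>x. (g x)\<^sup>2 + (h x)\<^sup>2)"
    using assms by (simp add: square_integrable_def)
  show "(\<lambda>x. g x * h x) \<in> borel_measurable M"
    using assms by (auto simp: square_integrable_def)
  have "norm (a * b) \<le> norm (a\<^sup>2 + b\<^sup>2)" for a b :: real
  proof -
    have "2 * (\<bar>a\<bar> * \<bar>b\<bar>) \<le> a\<^sup>2 + b\<^sup>2"
      using sum_squares_bound[of "\<bar>a\<bar>" "\<bar>b\<bar>"] by simp
    moreover have "0 \<le> \<bar>a\<bar> * \<bar>b\<bar>" by simp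
    ultimately have "\<bar>a\<bar> * \<bar>b\<bar> \<le> a\<^sup>2 + b\<^sup>2" by linarith
    then show ?thesis by (simp add: abs_mult)
  qed
  then show "AE x in M. norm (g x * h x) \<le> norm ((g x)\<^sup>2 + (h x)\<^sup>2)"
    by (intro always_eventually) blast
qed

lemma square_integrable_diff:
  assumes "g \<in> square_integrable M" "h \<in> square_integrable M"
  shows "(\<lambda>x. g x - h x) \<in> square_integrable M"
proof -
  have "integrable M (\<lambda>x. (g x)\<^sup>2 + (h x)\<^sup>2 - 2 * (g x * h x))"
    using assms square_integrable_mult[OF assms] by (simp add: square_integrable_def)
  then have "integrable M (\<lambda>x. (g x - h x)\<^sup>2)"
    by (simp add: power2_diff mult.assoc)
  then show ?thesis
    using assms by (auto simp: square_integrable_def)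
qed

lemma L2_minkowski:
  assumes a: "a \<in> square_integrable M" and b: "b \<in> square_integrable M"
  shows "sqrt (integral\<^sup>L M (\<lambda>x. (a x + b x)\<^sup>2)) \<le>
         sqrt (integral\<^sup>L M (\<lambda>x. (a x)\<^sup>2)) + sqrt (integral\<^sup>L M (\<lambda>x. (b x)\<^sup>2))"
proof -
  define A B C where "A = integral\<^sup>L M (\<lambda>x. (a x)\<^sup>2)"
    and "B = integral\<^sup>L M (\<lambda>x. (b x)\<^sup>2)" and "C = integral\<^sup>L M (\<lambda>x. a x * b x)"
  have ia: "integrable M (\<lambda>x. (a x)\<^sup>2)" and ib: "integrable M (\<lambda>x. (b x)\<^sup>2)"
    and iab: "integrable M (\<lambda>x. a x * b x)"
    using a b square_integrable_mult[OF a b] by (auto simp: square_integrable_def)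
  have A0: "A \<ge> 0" and B0: "B \<ge> 0"
    by (simp_all add: A_def B_def)
  have quad: "0 \<le> s\<^sup>2 * A + t\<^sup>2 * B - 2 * s * t * C" for s t
  proof -
    have "0 \<le> integral\<^sup>L M (\<lambda>x. (s * a x - t * b x)\<^sup>2)"
      by simp
    also have "(\<lambda>x. (s * a x - t * b x)\<^sup>2) =
        (\<lambda>x. s\<^sup>2 * (a x)\<^sup>2 + t\<^sup>2 * (b x)\<^sup>2 - 2 * s * t * (a x * b x))"
      by (rule ext) (simp add: power2_eq_square algebra_simps)
    also have "integral\<^sup>L M \<dots> = s\<^sup>2 * A + t\<^sup>2 * B - 2 * s * t * C"
      using ia ib iab by (simp add: A_def B_def C_def)
    finally show ?thesis .
  qed
  have CAB: "C \<le> sqrt A * sqrt B"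
  proof (cases "A = 0 \<or> B = 0")
    case True
    then have "C \<le> 0"
    proof
      assume A: "A = 0"
      have "0 \<le> B - 2 * s * C" for s
        using quad[of s 1] A by simp
      from this[of "(B + 1) / (2 * C)"] show ?thesis
        using B0 by (cases "C = 0") auto
    next
      assume B: "B = 0"
      have "0 \<le> A - 2 * t * C" for t
        using quad[of 1 t] B by simp
      from this[of "(A + 1) / (2 * C)"] show ?thesis
        using A0 by (cases "C = 0") auto
    qed
    then show ?thesis
      using A0 B0 by (meson mult_nonneg_nonneg order_trans real_sqrt_ge_zero)
  next
    case False
    then have pos: "0 < sqrt A" "0 < sqrt B"
      using A0 B0 by auto
    have "0 \<le> (sqrt B)\<^sup>2 * A + (sqrt A)\<^sup>2 * B - 2 * sqrt B * sqrt A * C"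
      by (rule quad)
    also have "\<dots> = 2 * (sqrt A * sqrt B) * (sqrt A * sqrt B - C)"
      using A0 B0 real_sqrt_mult_self[of A] real_sqrt_mult_self[of B]
      by (simp add: algebra_simps)
    finally show ?thesis
      using pos mult_pos_pos[OF pos] by (simp add: zero_le_mult_iff del: zero_less_mult_iff real_sqrt_gt_0_iff)
  qed
  have "integral\<^sup>L M (\<lambda>x. (a x + b x)\<^sup>2) = integral\<^sup>L M (\<lambda>x. (a x)\<^sup>2 + (b x)\<^sup>2 + 2 * (a x * b x))"
    by (simp add: power2_sum mult.assoc)
  also have "\<dots> = A + B + 2 * C"
    using ia ib iab by (simp add: A_def B_def C_def)
  also have "\<dots> \<le> (sqrt A + sqrt B)\<^sup>2"
    using CAB A0 B0 by (simp add: power2_sum)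
  finally show ?thesis
    using A0 B0 by (simp add: real_le_lsqrt flip: A_def B_def)
qed

lemma L2_dist_class:
  assumes g: "g \<in> square_integrable M" and h: "h \<in> square_integrable M"
  shows "L2_dist M (L2_class M g) (L2_class M h) = sqrt (integral\<^sup>L M (\<lambda>x. (g x - h x)\<^sup>2))"
proof -
  define g' where "g' = (SOME g'. g' \<in> L2_class M g)"
  define h' where "h' = (SOME h'. h' \<in> L2_class M h)"
  have "g \<in> L2_class M g" "h \<in> L2_class M h"
    using g h by (auto simp: L2_class_def)
  then have "g' \<in> L2_class M g" "h' \<in> L2_class M h"
    using someI[of "\<lambda>u. u \<in> L2_class M g" g] someI[of "\<lambda>u. u \<in> L2_class M h" h]
    by (simp_all add: g'_def h'_def)
  then have *: "g' \<in> square_integrable M" "h' \<in> square_integrable M"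
      "AE x in M. g' x = g x" "AE x in M. h' x = h x"
    by (auto simp: L2_class_def)
  have "integral\<^sup>L M (\<lambda>x. (g' x - h' x)\<^sup>2) = integral\<^sup>L M (\<lambda>x. (g x - h x)\<^sup>2)"
  proof (rule integral_cong_AE)
    show "(\<lambda>x. (g' x - h' x)\<^sup>2) \<in> borel_measurable M" "(\<lambda>x. (g x - h x)\<^sup>2) \<in> borel_measurable M"
      using * g h by (auto simp: square_integrable_def)
    show "AE x in M. (g' x - h' x)\<^sup>2 = (g x - h x)\<^sup>2"
      using *(3,4) by eventually_elim simp
  qed
  then show ?thesis
    by (simp add: L2_dist_def g'_def h'_def)
qed

lemma L2_class_eq_iff:
  assumes g: "g \<in> square_integrable M" and h: "h \<in> square_integrable M"
  shows "L2_class M g = L2_class M h \<longleftrightarrow> (AE x in M. g x = h x)"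
proof
  assume "L2_class M g = L2_class M h"
  moreover have "g \<in> L2_class M g"
    using g by (simp add: L2_class_def)
  ultimately show "AE x in M. g x = h x"
    by (simp add: L2_class_def)
next
  assume "AE x in M. g x = h x"
  then have "(AE x in M. u x = g x) \<longleftrightarrow> (AE x in M. u x = h x)" for u
    by (intro eventually_subst) (auto elim: eventually_mono)
  then show "L2_class M g = L2_class M h"
    by (simp add: L2_class_def)
qed

lemma Metric_space_L2: "Metric_space (L2_class M ` square_integrable M) (L2_dist M)"
proof
  show "0 \<le> L2_dist M G H" for G H
    by (simp add: L2_dist_def)
  show "L2_dist M G H = L2_dist M H G" for G H
    by (simp add: L2_dist_def power2_commute)
  show "L2_dist M G H = 0 \<longleftrightarrow> G = H"
    if G: "G \<in> L2_class M ` square_integrable M" and H: "H \<in> L2_class M ` square_integrable M"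
    for G H
  proof -
    obtain g h where gh: "g \<in> square_integrable M" "h \<in> square_integrable M"
      "G = L2_class M g" "H = L2_class M h"
      using G H by blast
    have "integrable M (\<lambda>x. (g x - h x)\<^sup>2)"
      using square_integrable_diff[OF gh(1,2)] by (simp add: square_integrable_def)
    then show ?thesis
      using gh by (simp add: L2_dist_class L2_class_eq_iff integral_nonneg_eq_0_iff_AE)
  qed
  show "L2_dist M G K \<le> L2_dist M G H + L2_dist M H K"
    if G: "G \<in> L2_class M ` square_integrable M" and H: "H \<in> L2_class M ` square_integrable M"
      and K: "K \<in> L2_class M ` square_integrable M" for G H K
  proof -
    obtain g h k where gh: "g \<in> square_integrable M" "h \<in> square_integrable M"
      "k \<in> square_integrable M" "G = L2_class M g" "H = L2_class M h" "K = L2_class M k"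
      using G H K by blast
    show ?thesis
      using gh L2_minkowski[OF square_integrable_diff[OF gh(1,2)] square_integrable_diff[OF gh(2,3)]]
      by (simp add: L2_dist_class)
  qed
qed

lemma mspace_L2_metric [simp]: "mspace (L2_metric M) = L2_class M ` square_integrable M"
  by (simp add: L2_metric_def Metric_space.mspace_metric Metric_space_L2)

lemma mdist_L2_metric [simp]: "mdist (L2_metric M) = L2_dist M"
  by (simp add: L2_metric_def Metric_space.mdist_metric Metric_space_L2)


section \<open>Laws of processes and the 2-Wasserstein distance\<close>

definition metric_borel :: "'e metric \<Rightarrow> 'e measure" where
  "metric_borel m = sigma (mspace m) {U. openin (mtopology_of m) U}"

text \<open>The law on \<open>m\<close> of a process whose paths lie in \<open>m\<close> almost surely: on the exceptional null set
  the path is replaced by an arbitrary point of \<open>m\<close>. The completion is taken because \<open>M\<close> is not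
  assumed complete, so that this modification need not be measurable with respect to \<open>M\<close>.\<close>

definition path_law :: "'w measure \<Rightarrow> 'e metric \<Rightarrow> ('w \<Rightarrow> 'e) \<Rightarrow> 'e measure" where
  "path_law M m g = distr (completion M) (metric_borel m)
     (\<lambda>\<omega>. if g \<omega> \<in> mspace m then g \<omega> else (SOME e. e \<in> mspace m))"

definition C_law :: "'w measure \<Rightarrow> 'a::topological_space set \<Rightarrow> ('w \<Rightarrow> 'a \<Rightarrow> real) \<Rightarrow> ('a \<Rightarrow> real) measure"
  where "C_law M X g = path_law M (C_space X) (\<lambda>\<omega>. restrict (g \<omega>) X)"

definition L2_law :: "'w measure \<Rightarrow> 'a::euclidean_space set \<Rightarrow> ('w \<Rightarrow> 'a \<Rightarrow> real) \<Rightarrow> ('a \<Rightarrow> real) set measure"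
  where "L2_law M X g = path_law M (L2_space X) (\<lambda>\<omega>. L2_class (lebesgue_on X) (g \<omega>))"

definition couplings :: "'e metric \<Rightarrow> 'e measure \<Rightarrow> 'e measure \<Rightarrow> ('e \<times> 'e) measure set" where
  "couplings m P Q = {\<pi>. sets \<pi> = sets (metric_borel m \<Otimes>\<^sub>M metric_borel m) \<and>
     distr \<pi> (metric_borel m) fst = P \<and> distr \<pi> (metric_borel m) snd = Q}"

definition ennreal_sqrt :: "ennreal \<Rightarrow> ennreal" where
  "ennreal_sqrt x = (if x = \<top> then \<top> else ennreal (sqrt (enn2real x)))"

definition wasserstein2 :: "'e metric \<Rightarrow> 'e measure \<Rightarrow> 'e measure \<Rightarrow> ennreal" where
  "wasserstein2 m P Q = ennreal_sqrt
     (INF \<pi>\<in>couplings m P Q. \<integral>\<^sup>+ p. ennreal ((mdist m (fst p) (snd p))\<^sup>2) \<partial>\<pi>)"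


section \<open>Kernels and Gaussian processes\<close>

definition kernel_on :: "'a set \<Rightarrow> ('a \<Rightarrow> 'a \<Rightarrow> real) \<Rightarrow> bool" where
  "kernel_on X k \<longleftrightarrow> (\<forall>x\<in>X. \<forall>x'\<in>X. k x x' = k x' x) \<and>
     (\<forall>S c. finite S \<longrightarrow> S \<subseteq> X \<longrightarrow> (\<Sum>x\<in>S. \<Sum>x'\<in>S. c x * c x' * k x x') \<ge> 0)"

definition stationary_on :: "'a::ab_group_add set \<Rightarrow> ('a \<Rightarrow> 'a \<Rightarrow> real) \<Rightarrow> bool" where
  "stationary_on X k \<longleftrightarrow> (\<exists>\<kappa>. \<forall>x\<in>X. \<forall>x'\<in>X. k x x' = \<kappa> (x - x'))"

text \<open>The univariate normal law with variance \<open>v \<ge> 0\<close>, including the degenerate case.\<close>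

definition normal_law :: "real \<Rightarrow> real \<Rightarrow> real measure" where
  "normal_law m v = (if v = 0 then return borel m
     else density lborel (\<lambda>x. ennreal (normal_density m (sqrt v) x)))"

text \<open>Multivariate normality of a finite family, with a possibly singular covariance matrix: every
  linear combination is univariate normal with the corresponding mean and variance.\<close>

definition jointly_normal ::
  "'w measure \<Rightarrow> 'i set \<Rightarrow> ('i \<Rightarrow> 'w \<Rightarrow> real) \<Rightarrow> ('i \<Rightarrow> real) \<Rightarrow> ('i \<Rightarrow> 'i \<Rightarrow> real) \<Rightarrow> bool" where
  "jointly_normal M I Z m C \<longleftrightarrow>
     (\<forall>i\<in>I. Z i \<in> borel_measurable M) \<and> kernel_on I C \<and>
     (\<forall>c. distr M borel (\<lambda>\<omega>. \<Sum>i\<in>I. c i * Z i \<omega>) =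
        normal_law (\<Sum>i\<in>I. c i * m i) (\<Sum>i\<in>I. \<Sum>j\<in>I. c i * c j * C i j))"

definition gaussian_process ::
  "'w measure \<Rightarrow> 'a set \<Rightarrow> ('w \<Rightarrow> 'a \<Rightarrow> real) \<Rightarrow> ('a \<Rightarrow> real) \<Rightarrow> ('a \<Rightarrow> 'a \<Rightarrow> real) \<Rightarrow> bool" where
  "gaussian_process M X f \<mu> k \<longleftrightarrow>
     (\<forall>S. finite S \<longrightarrow> S \<subseteq> X \<longrightarrow> jointly_normal M S (\<lambda>x \<omega>. f \<omega> x) \<mu> k)"

definition gaussian_vector ::
  "'w measure \<Rightarrow> ('w \<Rightarrow> real^'l) \<Rightarrow> real^'l \<Rightarrow> real^'l^'l \<Rightarrow> bool" where
  "gaussian_vector M w m \<Sigma> \<longleftrightarrow>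
     jointly_normal M UNIV (\<lambda>i \<omega>. w \<omega> $ i) (\<lambda>i. m $ i) (\<lambda>i j. \<Sigma> $ i $ j)"

definition basis_prior :: "('l::finite \<Rightarrow> 'a \<Rightarrow> real) \<Rightarrow> ('w \<Rightarrow> real^'l) \<Rightarrow> 'w \<Rightarrow> 'a \<Rightarrow> real" where
  "basis_prior \<phi> w \<omega> x = (\<Sum>i\<in>UNIV. w \<omega> $ i * \<phi> i x)"


section \<open>Pathwise conditioning\<close>

definition kernel_matrix :: "('a \<Rightarrow> 'a \<Rightarrow> real) \<Rightarrow> 'a^'n \<Rightarrow> real^'n^'n" where
  "kernel_matrix k xs = (\<chi> i j. k (xs $ i) (xs $ j))"

definition pathwise_update ::
  "('a \<Rightarrow> 'a \<Rightarrow> real) \<Rightarrow> 'a^'n \<Rightarrow> real^'n \<Rightarrow> ('a \<Rightarrow> real) \<Rightarrow> 'a \<Rightarrow> real" where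
  "pathwise_update k xs y g x =
     g x + (\<chi> i. k x (xs $ i)) \<bullet> (matrix_inv (kernel_matrix k xs) *v (y - (\<chi> i. g (xs $ i))))"

definition conditioned ::
  "('a \<Rightarrow> 'a \<Rightarrow> real) \<Rightarrow> 'a^'n \<Rightarrow> real^'n \<Rightarrow> ('w \<Rightarrow> 'a \<Rightarrow> real) \<Rightarrow> 'w \<Rightarrow> 'a \<Rightarrow> real" where
  "conditioned k xs y f \<omega> = pathwise_update k xs y (f \<omega>)"

definition kernel_sup_norm :: "'a set \<Rightarrow> ('a \<Rightarrow> 'a \<Rightarrow> real) \<Rightarrow> real" where
  "kernel_sup_norm X k = (SUP (x, x')\<in>X \<times> X. \<bar>k x x'\<bar>)"

definition opnorm_inf_1 :: "real^'n^'n \<Rightarrow> real" where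
  "opnorm_inf_1 A = (SUP v\<in>{v. infnorm v \<le> 1}. \<Sum>i\<in>UNIV. \<bar>(A *v v) $ i\<bar>)"

definition C1_const ::
  "(real^'d) set \<Rightarrow> (real^'d \<Rightarrow> real^'d \<Rightarrow> real) \<Rightarrow> (real^'d)^'n \<Rightarrow> real" where
  "C1_const X k xs = sqrt 2 * diameter X powr (real CARD('d) / 2) *
     sqrt (1 + (kernel_sup_norm X k)\<^sup>2 * (opnorm_inf_1 (matrix_inv (kernel_matrix k xs)))\<^sup>2)"

end

theory Submission
  imports Defs
begin

text \<open>Conditioning is a deterministic map of the path, \<open>g \<mapsto> g + k(\<cdot>, X\<^sub>n) K\<^sup>-\<^sup>1 (y - g(X\<^sub>n))\<close>. From the
  supremum norm to \<open>L\<^sup>2\<close> this map is Lipschitz with constant \<open>C\<^sub>1\<close>: pointwise \<open>(a + b)\<^sup>2 \<le> 2 a\<^sup>2 + 2 b\<^sup>2\<close>,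
  and \<open>X\<close> lies in a cube of side \<open>diam X\<close>. Pushing any coupling of the priors forward along it gives
  a coupling of the conditioned processes. The law on \<open>C(X)\<close> is a Borel law because \<open>C(X)\<close> is
  separable, so that evaluations generate its Borel sets; and the conditioned paths are continuous
  because sample continuity of a Gaussian process makes its covariance kernel continuous.\<close>

section \<open>Continuous functions with the supremum norm\<close>

lemma mspace_C_space:
  assumes "compact X"
  shows "mspace (C_space X) = {g \<in> extensional X. continuous_on X g}"
  using assms compact_imp_bounded[OF compact_continuous_image[of X]]
  by (auto simp: C_space_def)

lemma mdist_C_space_le_iff:
  assumes "X \<noteq> {}" "g \<in> mspace (C_space X)" "h \<in> mspace (C_space X)"
  shows "mdist (C_space X) g h \<le> a \<longleftrightarrow> (\<forall>x\<in>X. \<bar>g x - h x\<bar> \<le> a)"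
  using assms cfunspace_mdist_le[of g "top_of_set X" euclidean_metric h a]
  by (simp add: C_space_def dist_real_def)

text \<open>These minima of cones with rational heights and apexes in a countable set witness separability:
  once the slope \<open>L\<close> is steep, each cone placed near the graph of a function stays above the graph, and
  the cones over a fine net bring the minimum close to it.\<close>

primrec cone_min :: "nat \<Rightarrow> (rat \<times> 'a::metric_space) list \<Rightarrow> 'a \<Rightarrow> real" where
  "cone_min L [] x = real L"
| "cone_min L (p # ps) x = min (of_rat (fst p) + real L * dist x (snd p)) (cone_min L ps x)"

lemma continuous_on_cone_min: "continuous_on X (cone_min L ps)"
proof (induction ps)
  case (Cons p ps)
  have "continuous_on X (\<lambda>x. min (of_rat (fst p) + real L * dist x (snd p)) (cone_min L ps x))"
    using Cons by (intro continuous_intros)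
  then show ?case by (simp add: cone_min.simps[abs_def])
qed simp

lemma cone_min_ge_iff:
  "a \<le> cone_min L ps x \<longleftrightarrow> a \<le> real L \<and> (\<forall>(q, d)\<in>set ps. a \<le> of_rat q + real L * dist x d)"
  by (induction ps) auto

lemma cone_min_le: "(q, d) \<in> set ps \<Longrightarrow> cone_min L ps x \<le> of_rat q + real L * dist x d"
  using cone_min_ge_iff[of "cone_min L ps x" L ps x] by auto

lemma cone_min_approx:
  fixes X :: "'a::metric_space set"
  assumes "compact X" and D: "D \<subseteq> X" "X \<subseteq> closure D" and g: "continuous_on X g" and "e > 0"
  shows "\<exists>L ps. snd ` set ps \<subseteq> D \<and> (\<forall>x\<in>X. \<bar>g x - cone_min L ps x\<bar> \<le> 3 * e)"
proof -
  obtain B where B: "\<And>x. x \<in> X \<Longrightarrow> \<bar>g x\<bar> \<le> B"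
    using compact_imp_bounded[OF compact_continuous_image[OF g \<open>compact X\<close>]]
    by (auto simp: bounded_iff)
  obtain \<delta> where "\<delta> > 0" and \<delta>: "\<And>x x'. x \<in> X \<Longrightarrow> x' \<in> X \<Longrightarrow> dist x' x < \<delta> \<Longrightarrow> \<bar>g x' - g x\<bar> < e"
    using compact_uniformly_continuous[OF g \<open>compact X\<close>] \<open>e > 0\<close>
    unfolding uniformly_continuous_on_def by (metis dist_real_def)
  \<comment> \<open>\<open>B \<le> L\<close> keeps the base value \<open>L\<close> above
    \<open>g\<close>. \<open>2 * B / \<delta> \<le> L\<close> makes a cone rise by at least
    \<open>2 * B\<close>, a bound for the oscillation of \<open>g\<close>, by the time the distance
    reaches \<open>\<delta>\<close>.\<close>
  obtain L :: nat where L: "max B (2 * B / \<delta>) \<le> real L"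
    using real_arch_simple by blast
  \<comment> \<open>A centre \<open>d\<close> closer than \<open>\<eta>\<close> has
    \<open>g d\<close> within \<open>e\<close> of \<open>g x\<close>, and its cone rises by at most
    \<open>e\<close> on the way to \<open>x\<close>. The \<open>+ 1\<close> guards against
    \<open>L = 0\<close>.\<close>
  define \<eta> where "\<eta> = min \<delta> (e / (real L + 1))"
  have "\<eta> > 0"
    using \<open>\<delta> > 0\<close> \<open>e > 0\<close> by (simp add: \<eta>_def)
  have "X \<subseteq> (\<Union>d\<in>D. ball d \<eta>)"
  proof
    fix x assume "x \<in> X"
    then show "x \<in> (\<Union>d\<in>D. ball d \<eta>)"
      using D \<open>\<eta> > 0\<close> closure_approachable[of x D] by auto
  qed
  then obtain D' where D': "D' \<subseteq> D" "finite D'" "X \<subseteq> (\<Union>d\<in>D'. ball d \<eta>)"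
    using compactE_image[OF \<open>compact X\<close>, of D "\<lambda>d. ball d \<eta>"] by blast
  obtain ds where ds: "set ds = D'"
    using finite_list[OF \<open>finite D'\<close>] by blast
  have "\<exists>q. \<bar>of_rat q - g d\<bar> < e" for d
    using of_rat_dense[of "g d - e" "g d + e"] \<open>e > 0\<close> by (auto simp: abs_diff_less_iff)
  then obtain q where q: "\<And>d. \<bar>of_rat (q d) - g d\<bar> < e"
    by metis
  define ps where "ps = map (\<lambda>d. (q d, d)) ds"
  show ?thesis
  proof (intro exI[of _ L] exI[of _ ps] conjI ballI)
    show "snd ` set ps \<subseteq> D"
      using D' ds by (auto simp: ps_def)
    fix x assume "x \<in> X"
    \<comment> \<open>Near \<open>d\<close>, uniform continuity costs one \<open>e\<close> and the
      rational height another. Far from \<open>d\<close>, the slope lifts the cone above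
      \<open>B - e\<close>.\<close>
    have "g x - 2 * e \<le> of_rat (q d) + real L * dist x d" if "d \<in> D'" for d
    proof (cases "dist x d < \<delta>")
      case True
      then have "\<bar>g x - g d\<bar> < e"
        using \<delta> \<open>x \<in> X\<close> that D' D by blast
      moreover have "0 \<le> real L * dist x d"
        by simp
      ultimately show ?thesis
        using q[of d] by linarith
    next
      case False
      have "2 * B \<le> real L * \<delta>"
        using L \<open>\<delta> > 0\<close> by (simp add: pos_divide_le_eq)
      also have "\<dots> \<le> real L * dist x d"
        using False by (intro mult_left_mono) auto
      finally show ?thesis
        using q[of d] B[OF \<open>x \<in> X\<close>] B[of d] that D' D \<open>e > 0\<close> by fastforce
    qed
    moreover have "g x \<le> real L"
      using B[OF \<open>x \<in> X\<close>] L by linarith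
    ultimately have lower: "g x - 2 * e \<le> cone_min L ps x"
      using \<open>e > 0\<close> ds by (auto simp: cone_min_ge_iff ps_def)
    obtain d where d: "d \<in> D'" "dist d x < \<eta>"
      using D' \<open>x \<in> X\<close> by auto
    have "cone_min L ps x \<le> of_rat (q d) + real L * dist x d"
      using d ds by (intro cone_min_le) (auto simp: ps_def)
    moreover have "(real L + 1) * dist x d \<le> e"
      using d by (simp add: \<eta>_def dist_commute pos_less_divide_eq mult.commute)
    then have "real L * dist x d \<le> e"
      using zero_le_dist[of x d] unfolding distrib_right by linarith
    moreover have "\<bar>g x - g d\<bar> < e"
      using \<delta>[of d x] d D' D \<open>x \<in> X\<close> by (auto simp: \<eta>_def dist_commute)
    ultimately show "\<bar>g x - cone_min L ps x\<bar> \<le> 3 * e"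
      using lower q[of d] \<open>e > 0\<close> by linarith
  qed
qed

text \<open>Finite lists over the rationals times a countable dense \<open>D\<close> are countable,
  so the cone minima form a countable dense family. They are restricted to \<open>X\<close> because
  points of \<open>C_space X\<close> are undefined off \<open>X\<close>.\<close>

lemma C_space_separable:
  fixes X :: "'a::{metric_space,second_countable_topology} set"
  assumes "compact X" "X \<noteq> {}"
  obtains E where "countable E" "E \<subseteq> mspace (C_space X)"
    "\<And>g e. g \<in> mspace (C_space X) \<Longrightarrow> e > 0 \<Longrightarrow> \<exists>h\<in>E. mdist (C_space X) g h \<le> e"
proof -
  obtain D where D: "countable D" "D \<subseteq> X" "X \<subseteq> closure D"
    using separable by metis
  define E where "E = (\<lambda>(L, ps). restrict (cone_min L ps) X) ` (UNIV \<times> lists (UNIV \<times> D))"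
  show thesis
  proof
    show "countable E"
      unfolding E_def using D by (intro countable_image countable_SIGMA countable_lists) auto
    show sub: "E \<subseteq> mspace (C_space X)"
      by (auto simp: E_def mspace_C_space[OF \<open>compact X\<close>]
          intro!: continuous_on_eq[OF continuous_on_cone_min])
    fix g and e :: real
    assume g: "g \<in> mspace (C_space X)" and "e > 0"
    then have "continuous_on X g" "e / 3 > 0"
      by (auto simp: mspace_C_space[OF \<open>compact X\<close>])
    obtain L ps
      where *: "snd ` set ps \<subseteq> D" "\<forall>x\<in>X. \<bar>g x - cone_min L ps x\<bar> \<le> 3 * (e / 3)"
      using cone_min_approx[OF \<open>compact X\<close> D(2,3) \<open>continuous_on X g\<close> \<open>e / 3 > 0\<close>] by blast
    have "restrict (cone_min L ps) X \<in> E"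
      unfolding E_def using *(1) by (intro image_eqI[of _ _ "(L, ps)"]) (auto simp: lists_eq_set)
    moreover from this have "mdist (C_space X) g (restrict (cone_min L ps) X) \<le> e"
      using * g sub \<open>X \<noteq> {}\<close> by (subst mdist_C_space_le_iff) auto
    ultimately show "\<exists>h\<in>E. mdist (C_space X) g h \<le> e"
      by blast
  qed
qed

section \<open>Borel measurability\<close>

lemma space_metric_borel [simp]: "space (metric_borel m) = mspace m"
  by (simp add: metric_borel_def space_measure_of_conv)

lemma openin_subset_mspace: "openin (mtopology_of m) U \<Longrightarrow> U \<subseteq> mspace m"
  using openin_subset[of "mtopology_of m" U] by simp

lemma metric_borel_open: "openin (mtopology_of m) U \<Longrightarrow> U \<in> sets (metric_borel m)"
  using openin_subset_mspace[of m] by (auto simp: metric_borel_def)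

lemma measurable_metric_borelI:
  assumes "F \<in> space M \<rightarrow> mspace m"
    and "\<And>U. openin (mtopology_of m) U \<Longrightarrow> F -` U \<inter> space M \<in> sets M"
  shows "F \<in> M \<rightarrow>\<^sub>M metric_borel m"
  unfolding metric_borel_def
  by (rule measurable_measure_of) (use assms openin_subset_mspace[of m] in auto)

lemma continuous_map_measurable:
  assumes "continuous_map (mtopology_of m) (mtopology_of m') F"
  shows "F \<in> metric_borel m \<rightarrow>\<^sub>M metric_borel m'"
proof (rule measurable_metric_borelI)
  show "F \<in> space (metric_borel m) \<rightarrow> mspace m'"
    using continuous_map_funspace[OF assms] by simp
  fix U assume "openin (mtopology_of m') U"
  from metric_borel_open[OF openin_continuous_map_preimage[OF assms this]]
  show "F -` U \<inter> space (metric_borel m) \<in> sets (metric_borel m)"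
    by (simp add: vimage_def Int_def conj_commute)
qed

text \<open>By separability, every open set is a countable union of closed balls with centres in
  \<open>E\<close> and radii \<open>1 / (n + 1)\<close>. Preimages of balls therefore decide
  measurability.\<close>

lemma measurable_separable_metric_borel:
  assumes E: "countable E" "E \<subseteq> mspace m" "\<And>g e. g \<in> mspace m \<Longrightarrow> e > 0 \<Longrightarrow> \<exists>h\<in>E. mdist m g h \<le> e"
    and F: "F \<in> space M \<rightarrow> mspace m"
    and ball: "\<And>e r. e \<in> E \<Longrightarrow> {\<omega> \<in> space M. mdist m e (F \<omega>) \<le> r} \<in> sets M"
  shows "F \<in> M \<rightarrow>\<^sub>M metric_borel m"
proof (rule measurable_metric_borelI[OF F])
  interpret Metric_space "mspace m" "mdist m" by simp
  fix U assume "openin (mtopology_of m) U"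
  then have U: "U \<subseteq> mspace m" "\<And>u. u \<in> U \<Longrightarrow> \<exists>r>0. mcball u r \<subseteq> U"
    by (simp_all add: mtopology_of_def openin_mtopology_mcball)
  define J where "J = {(e, n::nat). e \<in> E \<and> mcball e (inverse (real (Suc n))) \<subseteq> U}"
  have "countable J"
    by (rule countable_subset[of _ "E \<times> UNIV"]) (use E in \<open>auto simp: J_def\<close>)
  have "F -` U \<inter> space M = (\<Union>(e, n)\<in>J. {\<omega> \<in> space M. mdist m e (F \<omega>) \<le> inverse (real (Suc n))})"
  proof (intro equalityI subsetI)
    fix \<omega> assume "\<omega> \<in> F -` U \<inter> space M"
    then obtain r where \<omega>: "\<omega> \<in> space M" "F \<omega> \<in> U" and r: "r > 0" "mcball (F \<omega>) r \<subseteq> U"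
      using U by blast
    \<comment> \<open>Half of \<open>r\<close>, because the ball around \<open>e\<close> reaches at
      most twice its radius away from \<open>F \<omega>\<close>.\<close>
    obtain n where n: "inverse (real (Suc n)) < r / 2"
      using reals_Archimedean[of "r / 2"] r by auto
    obtain e where e: "e \<in> E" "mdist m (F \<omega>) e \<le> inverse (real (Suc n))"
      using E(3)[of "F \<omega>" "inverse (real (Suc n))"] \<omega> U(1) by auto
    have "mcball e (inverse (real (Suc n))) \<subseteq> mcball (F \<omega>) r"
      using e n \<omega> U(1) by (intro mcball_subset) (auto simp: commute)
    then have "(e, n) \<in> J"
      using e r by (auto simp: J_def)
    then show "\<omega> \<in> (\<Union>(e, n)\<in>J. {\<omega> \<in> space M. mdist m e (F \<omega>) \<le> inverse (real (Suc n))})"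
      using e \<omega> by (auto simp: commute)
  next
    fix \<omega> assume "\<omega> \<in> (\<Union>(e, n)\<in>J. {\<omega> \<in> space M. mdist m e (F \<omega>) \<le> inverse (real (Suc n))})"
    then obtain e n where \<omega>: "\<omega> \<in> space M" "mdist m e (F \<omega>) \<le> inverse (real (Suc n))"
      and e: "e \<in> E" "mcball e (inverse (real (Suc n))) \<subseteq> U"
      by (auto simp: J_def)
    then have "F \<omega> \<in> mcball e (inverse (real (Suc n)))"
      using E(2) F by auto
    then show "\<omega> \<in> F -` U \<inter> space M"
      using e \<omega> by auto
  qed
  also have "\<dots> \<in> sets M"
    using ball by (intro sets.countable_UN'[OF \<open>countable J\<close>]) (auto simp: J_def)
  finally show "F -` U \<inter> space M \<in> sets M" .
qed

text \<open>A closed ball of the supremum norm is cut out by countably many conditions on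
  evaluations, one for each point of a dense subset of \<open>X\<close>.\<close>

lemma measurable_C_space:
  fixes X :: "'a::{metric_space,second_countable_topology} set"
  assumes "compact X" "X \<noteq> {}" and F: "F \<in> space M \<rightarrow> mspace (C_space X)"
    and eval: "\<And>x. x \<in> X \<Longrightarrow> (\<lambda>\<omega>. F \<omega> x) \<in> borel_measurable M"
  shows "F \<in> M \<rightarrow>\<^sub>M metric_borel (C_space X)"
proof -
  obtain E where E: "countable E" "E \<subseteq> mspace (C_space X)"
    "\<And>g e. g \<in> mspace (C_space X) \<Longrightarrow> e > 0 \<Longrightarrow> \<exists>h\<in>E. mdist (C_space X) g h \<le> e"
    using C_space_separable[OF \<open>compact X\<close> \<open>X \<noteq> {}\<close>] by metis
  obtain D where D: "countable D" "D \<subseteq> X" "X \<subseteq> closure D"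
    using separable by metis
  show ?thesis
  proof (rule measurable_separable_metric_borel[OF E F])
    fix e and r :: real
    assume "e \<in> E"
    have "mdist (C_space X) e (F \<omega>) \<le> r \<longleftrightarrow> (\<forall>x\<in>D. \<bar>e x - F \<omega> x\<bar> \<le> r)" if "\<omega> \<in> space M" for \<omega>
    proof -
      have mem: "e \<in> mspace (C_space X)" "F \<omega> \<in> mspace (C_space X)"
        using \<open>e \<in> E\<close> E F that by auto
      then have "continuous_on X (\<lambda>x. \<bar>e x - F \<omega> x\<bar>)"
        by (auto simp: mspace_C_space[OF \<open>compact X\<close>] intro!: continuous_intros)
      \<comment> \<open>A closed inequality between continuous functions passes from
        \<open>D\<close> to its closure, which is \<open>X\<close> because \<open>X\<close> is
        closed.\<close>
      then have "(\<forall>x\<in>D. \<bar>e x - F \<omega> x\<bar> \<le> r) \<longleftrightarrow> (\<forall>x\<in>X. \<bar>e x - F \<omega> x\<bar> \<le> r)"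
        using D continuous_le_on_closure[of D "\<lambda>x. \<bar>e x - F \<omega> x\<bar>" _ r]
        by (smt (verit) closedin_closed_eq closure_closed closure_minimal compact_imp_closed
            assms(1) subset_antisym subsetD)
      then show ?thesis
        using mem \<open>X \<noteq> {}\<close> by (simp add: mdist_C_space_le_iff)
    qed
    then have "{\<omega> \<in> space M. mdist (C_space X) e (F \<omega>) \<le> r} =
        {\<omega> \<in> space M. \<forall>x\<in>D. \<bar>e x - F \<omega> x\<bar> \<le> r}"
      by auto
    also have "\<dots> \<in> sets M"
      proof (rule sets.sets_Collect_countable_All'[OF _ \<open>countable D\<close>])
      fix x assume "x \<in> D"
      then have [measurable]: "(\<lambda>\<omega>. F \<omega> x) \<in> borel_measurable M"
        using D eval by auto
      show "{\<omega> \<in> space M. \<bar>e x - F \<omega> x\<bar> \<le> r} \<in> sets M"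
        by measurable
    qed
    finally show "{\<omega> \<in> space M. mdist (C_space X) e (F \<omega>) \<le> r} \<in> sets M" .
  qed
qed

text \<open>In a complete measure space, a set that differs from a measurable one by a null set is
  measurable. This admits the arbitrary replacement of paths in \<open>path_law\<close>.\<close>

lemma measurable_completion_cong_AE:
  assumes f: "f \<in> completion M \<rightarrow>\<^sub>M N" and "AE \<omega> in M. f \<omega> = g \<omega>" and g: "g \<in> space M \<rightarrow> space N"
  shows "g \<in> completion M \<rightarrow>\<^sub>M N"
proof (rule measurableI)
  show "g \<omega> \<in> space N" if "\<omega> \<in> space (completion M)" for \<omega>
    using g that by auto
  fix A assume "A \<in> sets N"
  show "g -` A \<inter> space (completion M) \<in> sets (completion M)"
  proof (rule completion.in_sets_AE)
    show "f -` A \<inter> space (completion M) \<in> sets (completion M)"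
      using f \<open>A \<in> sets N\<close> by (rule measurable_sets)
    show "AE \<omega> in completion M. \<omega> \<in> f -` A \<inter> space (completion M) \<longleftrightarrow>
        \<omega> \<in> g -` A \<inter> space (completion M)"
      using AE_completion[OF assms(2)] by eventually_elim simp
  qed (use g in auto)
qed

text \<open>The integrands \<open>u\<close> and \<open>v\<close> are not assumed measurable, since a
  distance need not be measurable for the product of the Borel sigma-algebras. The change of
  variables is therefore applied only to the simple functions below \<open>u\<close> that define its
  integral.\<close>

lemma nn_integral_distr_le_cmult:
  assumes F: "F \<in> M \<rightarrow>\<^sub>M N" and "c \<ge> 0"
    and le: "\<And>x. x \<in> space M \<Longrightarrow> u (F x) \<le> ennreal c * v x"
  shows "(\<integral>\<^sup>+ y. u y \<partial>distr M N F) \<le> ennreal c * (\<integral>\<^sup>+ x. v x \<partial>M)"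
  unfolding nn_integral_def[of "distr M N F"]
proof (rule SUP_least, safe)
  fix s assume s: "simple_function (distr M N F) s" and "s \<le> u"
  have [measurable]: "s \<in> borel_measurable N"
    using borel_measurable_simple_function[OF s] by simp
  have "integral\<^sup>S (distr M N F) s = (\<integral>\<^sup>+ x. s (F x) \<partial>M)"
    using s F by (simp add: nn_integral_eq_simple_integral[symmetric] nn_integral_distr)
  also have "\<dots> \<le> ennreal c * (\<integral>\<^sup>+ x. v x \<partial>M)"
  proof (cases "c = 0")
    case True
    have "(\<integral>\<^sup>+ x. s (F x) \<partial>M) = (\<integral>\<^sup>+ x. 0 \<partial>M)"
    proof (rule nn_integral_cong)
      fix x assume "x \<in> space M"
      then have "s (F x) \<le> ennreal c * v x"
        using le \<open>s \<le> u\<close> by (auto simp: le_fun_def intro: order_trans)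
      then show "s (F x) = 0"
        using True by simp
    qed
    then show ?thesis by simp
  next
    case False
    then have "c > 0" using \<open>c \<ge> 0\<close> by simp
    then have c: "ennreal c * ennreal (1 / c) = 1"
      by (simp flip: ennreal_mult)
    \<comment> \<open>The constant is pulled out of the integral of \<open>s (F x) / c\<close>,
      which is measurable, before this is compared with \<open>v\<close>.\<close>
    have "(\<integral>\<^sup>+ x. s (F x) \<partial>M) = (\<integral>\<^sup>+ x. ennreal c * (ennreal (1 / c) * s (F x)) \<partial>M)"
      by (simp add: c flip: mult.assoc)
    also have "\<dots> = ennreal c * (\<integral>\<^sup>+ x. ennreal (1 / c) * s (F x) \<partial>M)"
      using F by (intro nn_integral_cmult) measurable
    also have "\<dots> \<le> ennreal c * (\<integral>\<^sup>+ x. v x \<partial>M)"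
    proof (intro mult_left_mono nn_integral_mono)
      fix x assume "x \<in> space M"
      then have "s (F x) \<le> ennreal c * v x"
        using le \<open>s \<le> u\<close> by (auto simp: le_fun_def intro: order_trans)
      then have "ennreal (1 / c) * s (F x) \<le> ennreal (1 / c) * (ennreal c * v x)"
        by (intro mult_left_mono) auto
      then show "ennreal (1 / c) * s (F x) \<le> v x"
        using c by (simp add: mult.assoc[symmetric] mult.commute)
    qed simp
    finally show ?thesis .
  qed
  finally show "integral\<^sup>S (distr M N F) s \<le> ennreal c * (\<integral>\<^sup>+ x. v x \<partial>M)" .
qed

section \<open>Covariance kernels of processes with continuous paths\<close>

text \<open>Positive semidefiniteness, tested on \<open>s\<close> times the difference of the point
  masses at \<open>x\<close> and \<open>x'\<close> plus \<open>t\<close> times the point mass at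
  \<open>z\<close>.\<close>

lemma kernel_on_quadratic_form:
  assumes "kernel_on X k" and "x \<in> X" "x' \<in> X" "z \<in> X"
  shows "0 \<le> s\<^sup>2 * (k x x + k x' x' - 2 * k x x') + 2 * s * t * (k x z - k x' z) + t\<^sup>2 * k z z"
proof -
  define S where "S = {x, x', z}"
  \<comment> \<open>Adding indicators makes the weights accumulate when some of the three points
    coincide, so no case distinction is required.\<close>
  define c where "c u = s * of_bool (u = x) - s * of_bool (u = x') + t * of_bool (u = z)" for u
  have c: "(\<Sum>u\<in>S. c u * h u) = s * h x - s * h x' + t * h z" for h
  proof -
    have "(\<Sum>u\<in>S. c u * h u) = (\<Sum>u\<in>S. (if u = x then s * h u else 0)
        - (if u = x' then s * h u else 0) + (if u = z then t * h u else 0))"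
      by (rule sum.cong) (auto simp: c_def algebra_simps)
    then show ?thesis
      by (simp add: sum.distrib sum_subtractf S_def)
  qed
  have "0 \<le> (\<Sum>u\<in>S. \<Sum>u'\<in>S. c u * c u' * k u u')"
    using assms by (simp add: kernel_on_def S_def)
  also have "\<dots> = (\<Sum>u\<in>S. c u * (\<Sum>u'\<in>S. c u' * k u u'))"
    by (simp add: sum_distrib_left mult.assoc)
  also have "\<dots> = s\<^sup>2 * (k x x + k x' x' - 2 * k x x') + 2 * s * t * (k x z - k x' z) + t\<^sup>2 * k z z"
  proof -
    have "k x' x = k x x'" "k z x = k x z" "k z x' = k x' z"
      using assms by (auto simp: kernel_on_def)
    then show ?thesis
      unfolding c by (simp add: power2_eq_square algebra_simps)
  qed
  finally show ?thesis .
qed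

lemma discriminant_nonpos:
  fixes a b c :: real
  assumes "\<And>s t. 0 \<le> s\<^sup>2 * a + 2 * s * t * b + t\<^sup>2 * c"
  shows "b\<^sup>2 \<le> a * c"
proof (cases "c = 0")
  case True
  have "0 \<le> - (4 * b\<^sup>2)"
    \<comment> \<open>With \<open>c = 0\<close> the form is linear in \<open>t\<close>; at this
      choice the terms in \<open>a\<close> cancel and \<open>- 4 * b\<^sup>2\<close>
      remains.\<close>
    using assms[of "2 * b" "- (a + 1)"] True by (simp add: power2_eq_square algebra_simps)
  then show ?thesis
    using True by simp
next
  case False
  then have "c > 0"
    using assms[of 0 1] by simp
  have "0 \<le> c * (a * c - b\<^sup>2)"
    using assms[of c "- b"] by (simp add: power2_eq_square algebra_simps)
  then show ?thesis
    using \<open>c > 0\<close> by (simp add: zero_le_mult_iff)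
qed

text \<open>Cauchy-Schwarz for the semidefinite form of \<open>k\<close>: the covariance of an
  increment with the value at \<open>z\<close> is controlled by the variance of the
  increment.\<close>

lemma kernel_on_increment_bound:
  assumes "kernel_on X k" and "x \<in> X" "x' \<in> X" "z \<in> X"
  shows "(k x z - k x' z)\<^sup>2 \<le> (k x x + k x' x' - 2 * k x x') * k z z"
  by (rule discriminant_nonpos) (rule kernel_on_quadratic_form[OF assms])

lemma stationary_kernel_bound:
  assumes "kernel_on X k" "stationary_on X k" "x \<in> X" "x' \<in> X" "z \<in> X"
  shows "\<bar>k x x'\<bar> \<le> k z z"
proof -
  have "k x x = k z z" "k x' x' = k z z"
    using assms(2-) by (auto simp: stationary_on_def)
  then show ?thesis
    \<comment> \<open>With \<open>x'\<close> as third point, the weights \<open>1, 0\<close> test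
      the difference of the two point masses and \<open>1, 2\<close> their sum, which bounds
      \<open>k x x'\<close> from both sides.\<close>
    using kernel_on_quadratic_form[OF assms(1,3,4,4), of 1 0]
      kernel_on_quadratic_form[OF assms(1,3,4,4), of 1 2]
    by (simp add: abs_le_iff)
qed

text \<open>A real supremum dominates its members only when the set is bounded above; stationarity
  supplies the bound, because the diagonal of \<open>k\<close> is constant.\<close>

lemma kernel_le_sup_norm:
  assumes "kernel_on X k" "stationary_on X k" "x \<in> X" "x' \<in> X"
  shows "\<bar>k x x'\<bar> \<le> kernel_sup_norm X k"
proof -
  have "bdd_above ((\<lambda>(x, x'). \<bar>k x x'\<bar>) ` (X \<times> X))"
    using stationary_kernel_bound[OF assms(1,2) _ _ \<open>x \<in> X\<close>]
    by (auto intro!: bdd_aboveI[of _ "k x x"])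
  then show ?thesis
    unfolding kernel_sup_norm_def
    using assms(3,4) by (intro cSUP_upper2[where x = "(x, x')"]) auto
qed

text \<open>The density never exceeds its peak \<open>1 / sqrt (2 * pi * v)\<close>, so the bound is
  uniform in the mean.\<close>

lemma normal_law_centred_interval:
  assumes "v > 0" "e \<ge> 0"
  shows "measure (normal_law m v) {-e..e} \<le> 2 * e / sqrt (2 * pi * v)"
proof -
  have "emeasure (normal_law m v) {-e..e} =
      (\<integral>\<^sup>+ x. ennreal (normal_density m (sqrt v) x) * indicator {-e..e} x \<partial>lborel)"
    using \<open>v > 0\<close> by (simp add: normal_law_def emeasure_density)
  also have "\<dots> \<le> (\<integral>\<^sup>+ x. ennreal (1 / sqrt (2 * pi * v)) * indicator {-e..e} x \<partial>lborel)"
    using \<open>v > 0\<close>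
    by (intro nn_integral_mono mult_right_mono ennreal_leI)
      (auto simp: normal_density_def divide_right_mono)
  also have "\<dots> = ennreal (1 / sqrt (2 * pi * v)) * ennreal (2 * e)"
    using \<open>e \<ge> 0\<close> by (subst nn_integral_cmult_indicator) auto
  also have "\<dots> = ennreal (2 * e / sqrt (2 * pi * v))"
    using assms by (simp flip: ennreal_mult)
  finally show ?thesis
    unfolding measure_def using assms by (intro enn2real_leI) auto
qed

text \<open>By dominated convergence the mass of \<open>{-e..e}\<close> tends to 1, while a normal
  law whose variance stays large puts little mass on a short interval.\<close>

lemma (in prob_space) normal_variance_tendsto_0:
  assumes Z[measurable]: "\<And>n. Z n \<in> borel_measurable M"
    and law: "\<And>n. distr M borel (Z n) = normal_law (m n) (v n)" and v: "\<And>n. v n \<ge> 0"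
    and lim: "AE \<omega> in M. (\<lambda>n. Z n \<omega>) \<longlonglongrightarrow> 0"
  shows "v \<longlonglongrightarrow> 0"
proof (rule LIMSEQ_I)
  fix r :: real assume "r > 0"
  \<comment> \<open>With this \<open>e\<close>, mass above \<open>1 / 2\<close> forces
    \<open>2 * pi * v n < r\<close>, and hence \<open>v n < r\<close>.\<close>
  define e where "e = sqrt r / 4"
  have "e > 0" using \<open>r > 0\<close> by (simp add: e_def)
  have "(\<lambda>n. \<integral>\<omega>. indicator {-e..e} (Z n \<omega>) \<partial>M) \<longlonglongrightarrow> (\<integral>\<omega>. 1 \<partial>M :: real)"
  proof (rule integral_dominated_convergence[where w = "\<lambda>_. 1"])
    show "AE \<omega> in M. (\<lambda>n. indicator {-e..e} (Z n \<omega>) :: real) \<longlonglongrightarrow> 1"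
      using lim
    proof eventually_elim
      fix \<omega> assume "(\<lambda>n. Z n \<omega>) \<longlonglongrightarrow> 0"
      then have "eventually (\<lambda>n. dist (Z n \<omega>) 0 < e) sequentially"
        using \<open>e > 0\<close> by (rule tendstoD)
      then have "eventually (\<lambda>n. indicator {-e..e} (Z n \<omega>) = (1 :: real)) sequentially"
        by eventually_elim (auto simp: abs_less_iff)
      then show "(\<lambda>n. indicator {-e..e} (Z n \<omega>) :: real) \<longlonglongrightarrow> 1"
        by (rule tendsto_eventually)
    qed
  qed (auto split: split_indicator)
  also have "(\<integral>\<omega>. 1 \<partial>M :: real) = 1"
    by (simp add: prob_space)
  also have "(\<lambda>n. \<integral>\<omega>. indicator {-e..e} (Z n \<omega>) \<partial>M) = (\<lambda>n. measure (normal_law (m n) (v n)) {-e..e})"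
  proof
    fix n
    have "measure (normal_law (m n) (v n)) {-e..e} = measure M (Z n -` {-e..e} \<inter> space M)"
      by (simp add: measure_distr flip: law)
    also have "\<dots> = (\<integral>\<omega>. indicator (Z n -` {-e..e} \<inter> space M) \<omega> \<partial>M)"
      by simp
    also have "\<dots> = (\<integral>\<omega>. indicator {-e..e} (Z n \<omega>) \<partial>M)"
      by (rule Bochner_Integration.integral_cong) (auto split: split_indicator)
    finally show "(\<integral>\<omega>. indicator {-e..e} (Z n \<omega>) \<partial>M) = measure (normal_law (m n) (v n)) {-e..e}" ..
  qed
  finally have "eventually (\<lambda>n. 1 / 2 < measure (normal_law (m n) (v n)) {-e..e}) sequentially"
    by (rule order_tendstoD) simp
  then have "eventually (\<lambda>n. norm (v n - 0) < r) sequentially"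
  proof eventually_elim
    fix n assume half: "1 / 2 < measure (normal_law (m n) (v n)) {-e..e}"
    show "norm (v n - 0) < r"
    proof (cases "v n = 0")
      case False
      then have "v n > 0" using v[of n] by simp
      from half normal_law_centred_interval[OF this, of e "m n"] \<open>e > 0\<close>
      have "1 / 2 < 2 * e / sqrt (2 * pi * v n)"
        by simp
      then have "sqrt (2 * pi * v n) < sqrt r"
        using \<open>v n > 0\<close> by (simp add: e_def field_simps)
      then have "2 * pi * v n < r"
        by simp
      moreover have "1 * v n \<le> (2 * pi) * v n"
        using \<open>v n > 0\<close> pi_ge_two by (intro mult_right_mono) auto
      ultimately have "v n < r"
        by linarith
      then show ?thesis
        using \<open>v n > 0\<close> by simp
    qed (use \<open>r > 0\<close> in simp)
  qed
  then show "\<exists>N. \<forall>n\<ge>N. norm (v n - 0) < r"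
    by (simp add: eventually_sequentially)
qed

lemma gaussian_process_increment:
  assumes "gaussian_process M X f \<mu> k" and "x \<in> X" "x' \<in> X"
  shows "distr M borel (\<lambda>\<omega>. f \<omega> x - f \<omega> x') =
    normal_law (\<mu> x - \<mu> x') (k x x + k x' x' - 2 * k x x')"
proof -
  define S where "S = {x, x'}"
  define c where "c u = of_bool (u = x) - (of_bool (u = x') :: real)" for u
  have c: "(\<Sum>u\<in>S. c u * h u) = h x - h x'" for h
  proof -
    have "(\<Sum>u\<in>S. c u * h u) = (\<Sum>u\<in>S. (if u = x then h u else 0) - (if u = x' then h u else 0))"
      by (rule sum.cong) (auto simp: c_def)
    then show ?thesis
      by (simp add: sum_subtractf S_def)
  qed
  have *: "jointly_normal M S (\<lambda>x \<omega>. f \<omega> x) \<mu> k"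
    using assms by (simp add: gaussian_process_def S_def)
  then have "kernel_on S k"
    by (simp add: jointly_normal_def)
  then have sym: "k x' x = k x x'"
    unfolding kernel_on_def S_def by blast
  have "(\<Sum>u\<in>S. \<Sum>u'\<in>S. c u * c u' * k u u') = (\<Sum>u\<in>S. c u * (\<Sum>u'\<in>S. c u' * k u u'))"
    by (simp add: sum_distrib_left mult.assoc)
  also have "\<dots> = k x x + k x' x' - 2 * k x x'"
    unfolding c sym by simp
  finally have var: "(\<Sum>u\<in>S. \<Sum>u'\<in>S. c u * c u' * k u u') = k x x + k x' x' - 2 * k x x'" .
  have "distr M borel (\<lambda>\<omega>. \<Sum>u\<in>S. c u * f \<omega> u) =
      normal_law (\<Sum>u\<in>S. c u * \<mu> u) (\<Sum>u\<in>S. \<Sum>u'\<in>S. c u * c u' * k u u')"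
    using * unfolding jointly_normal_def by blast
  then show ?thesis
    unfolding var c .
qed

lemma gaussian_process_measurable:
  assumes "gaussian_process M X f \<mu> k" "x \<in> X"
  shows "(\<lambda>\<omega>. f \<omega> x) \<in> borel_measurable M"
proof -
  have "jointly_normal M {x} (\<lambda>x \<omega>. f \<omega> x) \<mu> k"
    using assms by (simp add: gaussian_process_def)
  then show ?thesis
    by (simp add: jointly_normal_def)
qed

text \<open>Almost sure convergence of the increments forces their variances to vanish, because a normal
  density of variance \<open>v\<close> is bounded by a multiple of \<open>1 / sqrt v\<close>.\<close>

lemma continuous_on_gaussian_kernel:
  fixes X :: "'a::metric_space set"
  assumes "prob_space M" and gp: "gaussian_process M X f \<mu> k" and "kernel_on X k"
    and cont: "AE \<omega> in M. continuous_on X (f \<omega>)" and "z \<in> X"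
  shows "continuous_on X (\<lambda>x. k x z)"
  unfolding continuous_on_sequentially comp_def
proof (intro allI ballI impI, elim conjE)
  interpret prob_space M by fact
  fix u and x :: 'a
  assume "x \<in> X" and u: "\<forall>n. u n \<in> X" and lim: "u \<longlonglongrightarrow> x"
  \<comment> \<open>The variance of the increment of \<open>f\<close> between \<open>x\<close> and
    \<open>u n\<close>.\<close>
  define v where "v n = k (u n) (u n) + k x x - 2 * k (u n) x" for n
  have v0: "0 \<le> v n" for n
    using kernel_on_quadratic_form[OF \<open>kernel_on X k\<close>, of "u n" x x 1 0] u \<open>x \<in> X\<close>
    by (simp add: v_def)
  have "v \<longlonglongrightarrow> 0"
  proof (rule normal_variance_tendsto_0)
    show "(\<lambda>\<omega>. f \<omega> (u n) - f \<omega> x) \<in> borel_measurable M" for n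
      using gaussian_process_measurable[OF gp] u \<open>x \<in> X\<close> by (intro borel_measurable_diff) auto
    show "distr M borel (\<lambda>\<omega>. f \<omega> (u n) - f \<omega> x) = normal_law (\<mu> (u n) - \<mu> x) (v n)" for n
      unfolding v_def using u \<open>x \<in> X\<close> by (intro gaussian_process_increment[OF gp]) auto
    show "AE \<omega> in M. (\<lambda>n. f \<omega> (u n) - f \<omega> x) \<longlonglongrightarrow> 0"
      using cont
    proof eventually_elim
      fix \<omega> assume "continuous_on X (f \<omega>)"
      then have "(\<lambda>n. f \<omega> (u n)) \<longlonglongrightarrow> f \<omega> x"
        using u lim \<open>x \<in> X\<close> by (auto simp: continuous_on_sequentially comp_def)
      then show "(\<lambda>n. f \<omega> (u n) - f \<omega> x) \<longlonglongrightarrow> 0"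
        by (simp add: LIM_zero_iff)
    qed
  qed (rule v0)
  then have "(\<lambda>n. sqrt (v n * k z z)) \<longlonglongrightarrow> sqrt (0 * k z z)"
    by (intro tendsto_intros)
  then have "(\<lambda>n. sqrt (v n * k z z)) \<longlonglongrightarrow> 0"
    by simp
  moreover have "\<forall>n. norm (k (u n) z - k x z) \<le> sqrt (v n * k z z)"
    using kernel_on_increment_bound[OF \<open>kernel_on X k\<close>, of "u _" x z] u \<open>x \<in> X\<close> \<open>z \<in> X\<close>
    by (auto simp: v_def intro!: real_le_rsqrt)
  ultimately have "(\<lambda>n. k (u n) z - k x z) \<longlonglongrightarrow> 0"
    by (rule Lim_null_comparison[OF always_eventually, rotated])
  then show "(\<lambda>n. k (u n) z) \<longlonglongrightarrow> k x z"
    by (simp add: LIM_zero_iff)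
qed

section \<open>The matrix norm and the volume bound\<close>

lemma opnorm_inf_1_bdd_above:
  fixes A :: "real^'n^'n"
  shows "bdd_above ((\<lambda>v. \<Sum>i\<in>UNIV. \<bar>(A *v v) $ i\<bar>) ` {v. infnorm v \<le> 1})"
proof (rule bdd_aboveI2)
  fix v :: "real^'n" assume "v \<in> {v. infnorm v \<le> 1}"
  then have v: "\<bar>v $ j\<bar> \<le> 1" for j
    using component_le_infnorm_cart[of v j] by simp
  show "(\<Sum>i\<in>UNIV. \<bar>(A *v v) $ i\<bar>) \<le> (\<Sum>i\<in>UNIV. \<Sum>j\<in>UNIV. \<bar>A $ i $ j\<bar>)"
  proof (rule sum_mono)
    fix i
    have "\<bar>(A *v v) $ i\<bar> \<le> (\<Sum>j\<in>UNIV. \<bar>A $ i $ j * v $ j\<bar>)"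
      by (simp add: matrix_vector_mult_def sum_abs)
    also have "\<dots> \<le> (\<Sum>j\<in>UNIV. \<bar>A $ i $ j\<bar>)"
      using v by (intro sum_mono) (simp add: abs_mult mult_left_le)
    finally show "\<bar>(A *v v) $ i\<bar> \<le> (\<Sum>j\<in>UNIV. \<bar>A $ i $ j\<bar>)" .
  qed
qed

text \<open>By homogeneity: division by \<open>D\<close> moves \<open>v\<close> into the unit ball
  of the supremum norm.\<close>

lemma opnorm_inf_1_bound:
  fixes A :: "real^'n^'n"
  assumes "\<And>j. \<bar>v $ j\<bar> \<le> D"
  shows "(\<Sum>i\<in>UNIV. \<bar>(A *v v) $ i\<bar>) \<le> opnorm_inf_1 A * D"
proof (cases "v = 0")
  case True
  have "(\<Sum>i\<in>UNIV. \<bar>(A *v 0) $ i\<bar>) \<le> opnorm_inf_1 A"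
    unfolding opnorm_inf_1_def by (intro cSUP_upper2[OF opnorm_inf_1_bdd_above, of 0]) (auto simp: infnorm_0)
  moreover have "0 \<le> D"
    using assms[of undefined] by linarith
  ultimately show ?thesis
    using True by simp
next
  case False
  then obtain j where "v $ j \<noteq> 0"
    by (auto simp: vec_eq_iff)
  then have "D > 0"
    using assms[of j] by linarith
  have "infnorm ((1 / D) *\<^sub>R v) \<le> 1"
    unfolding infnorm_cart by (rule cSup_least) (use assms \<open>D > 0\<close> in \<open>auto simp: abs_mult\<close>)
  then have "(\<Sum>i\<in>UNIV. \<bar>(A *v ((1 / D) *\<^sub>R v)) $ i\<bar>) \<le> opnorm_inf_1 A"
    unfolding opnorm_inf_1_def by (intro cSUP_upper[OF _ opnorm_inf_1_bdd_above]) simp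
  then have "(\<Sum>i\<in>UNIV. \<bar>(A *v v) $ i\<bar>) / D \<le> opnorm_inf_1 A"
    using \<open>D > 0\<close> by (simp add: matrix_vector_mult_scaleR abs_mult sum_divide_distrib)
  then show ?thesis
    using \<open>D > 0\<close> by (simp add: pos_divide_le_eq)
qed

text \<open>Each coordinate attains its minimum over \<open>X\<close>, at a point that may depend on
  the coordinate. The other points exceed it there by at most the diameter, so a cube of that side
  contains \<open>X\<close>.\<close>

lemma measure_le_diameter_power:
  fixes X :: "(real^'d) set"
  assumes "compact X" "X \<noteq> {}"
  shows "measure lebesgue X \<le> diameter X ^ CARD('d)"
proof -
  have "\<exists>a\<in>X. \<forall>x\<in>X. a $ i \<le> x $ i" for i
    using continuous_attains_inf[OF assms, of "\<lambda>x. x $ i"] by (simp add: continuous_on_component)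
  then obtain a where a: "\<And>i. a i \<in> X" "\<And>i x. x \<in> X \<Longrightarrow> a i $ i \<le> x $ i"
    by metis
  define l u where "l = (\<chi> i. a i $ i)" and "u = (\<chi> i. a i $ i + diameter X)"
  have d: "x $ i - a i $ i \<le> diameter X" if "x \<in> X" for x i
  proof -
    have "x $ i - a i $ i \<le> norm (x - a i)"
      using component_le_norm_cart[of "x - a i" i] by simp
    also have "\<dots> \<le> diameter X"
      using diameter_bounded_bound[of X x "a i"] assms that a by (simp add: compact_imp_bounded dist_norm)
    finally show ?thesis .
  qed
  have "X \<subseteq> cbox l u"
  proof
    fix x assume "x \<in> X"
    then have "a i $ i \<le> x $ i" "x $ i \<le> a i $ i + diameter X" for i
      using a(2)[of x i] d[of x i] by simp_all
    then show "x \<in> cbox l u"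
      by (simp add: mem_box_cart l_def u_def)
  qed
  then have "measure lebesgue X \<le> measure lebesgue (cbox l u)"
    using assms by (intro measure_mono_fmeasurable) (auto simp: lmeasurable_compact fmeasurableD)
  also have "\<dots> = diameter X ^ CARD('d)"
    using \<open>X \<subseteq> cbox l u\<close> \<open>X \<noteq> {}\<close> by (subst measure_completion, simp, subst content_cbox_cart) (auto simp: l_def u_def)
  finally show ?thesis .
qed

section \<open>Lipschitz images and the Wasserstein distance\<close>

lemma couplings_distr:
  assumes \<pi>: "\<pi> \<in> couplings m P Q" and F: "F \<in> metric_borel m \<rightarrow>\<^sub>M metric_borel m'"
  shows "distr \<pi> (metric_borel m' \<Otimes>\<^sub>M metric_borel m') (\<lambda>p. (F (fst p), F (snd p)))
    \<in> couplings m' (distr P (metric_borel m') F) (distr Q (metric_borel m') F)"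
proof -
  let ?B = "metric_borel m" and ?B' = "metric_borel m'"
  let ?G = "\<lambda>p. (F (fst p), F (snd p))"
  have sets: "sets \<pi> = sets (?B \<Otimes>\<^sub>M ?B)" and marg: "distr \<pi> ?B fst = P" "distr \<pi> ?B snd = Q"
    using \<pi> by (auto simp: couplings_def)
  have proj: "fst \<in> \<pi> \<rightarrow>\<^sub>M ?B" "snd \<in> \<pi> \<rightarrow>\<^sub>M ?B"
    by (simp_all add: measurable_cong_sets[OF sets refl])
  have G: "?G \<in> \<pi> \<rightarrow>\<^sub>M ?B' \<Otimes>\<^sub>M ?B'"
    using F proj by measurable
  have "distr (distr \<pi> (?B' \<Otimes>\<^sub>M ?B') ?G) ?B' fst = distr \<pi> ?B' (F \<circ> fst)"
    using G by (simp add: distr_distr comp_def)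
  moreover have "distr (distr \<pi> (?B' \<Otimes>\<^sub>M ?B') ?G) ?B' snd = distr \<pi> ?B' (F \<circ> snd)"
    using G by (simp add: distr_distr comp_def)
  moreover have "distr \<pi> ?B' (F \<circ> fst) = distr P ?B' F" "distr \<pi> ?B' (F \<circ> snd) = distr Q ?B' F"
    using F proj by (simp_all add: distr_distr flip: marg)
  ultimately show ?thesis
    by (simp add: couplings_def)
qed

text \<open>The product measure is a coupling.\<close>

lemma couplings_nonempty:
  assumes "prob_space P" "prob_space Q"
    and sets: "sets P = sets (metric_borel m)" "sets Q = sets (metric_borel m)"
  shows "couplings m P Q \<noteq> {}"
proof -
  interpret Q: prob_space Q by fact
  interpret P: prob_space P by fact
  have "distr (P \<Otimes>\<^sub>M Q) (metric_borel m) fst = P"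
    using Q.distr_pair_fst[of P] sets by (metis distr_cong)
  moreover have "distr (P \<Otimes>\<^sub>M Q) (metric_borel m) snd = Q"
  proof (rule measure_eqI)
    fix A assume A: "A \<in> sets (distr (P \<Otimes>\<^sub>M Q) (metric_borel m) snd)"
    then have "A \<in> sets Q"
      using sets by simp
    have "snd \<in> P \<Otimes>\<^sub>M Q \<rightarrow>\<^sub>M metric_borel m"
      using measurable_snd[of P Q] by (simp add: measurable_cong_sets[OF refl sets(2)])
    then have "emeasure (distr (P \<Otimes>\<^sub>M Q) (metric_borel m) snd) A =
        emeasure (P \<Otimes>\<^sub>M Q) (snd -` A \<inter> space (P \<Otimes>\<^sub>M Q))"
      using A by (simp add: emeasure_distr)
    also have "snd -` A \<inter> space (P \<Otimes>\<^sub>M Q) = space P \<times> A"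
      using sets.sets_into_space[OF \<open>A \<in> sets Q\<close>] by (auto simp: space_pair_measure)
    also have "emeasure (P \<Otimes>\<^sub>M Q) (space P \<times> A) = emeasure Q A"
      using \<open>A \<in> sets Q\<close> by (simp add: Q.emeasure_pair_measure_Times P.emeasure_space_1)
    finally show "emeasure (distr (P \<Otimes>\<^sub>M Q) (metric_borel m) snd) A = emeasure Q A" .
  qed (simp add: sets)
  moreover have "sets (P \<Otimes>\<^sub>M Q) = sets (metric_borel m \<Otimes>\<^sub>M metric_borel m)"
    using sets by (rule sets_pair_measure_cong)
  ultimately show ?thesis
    by (auto simp: couplings_def)
qed

lemma ennreal_sqrt_mono:
  assumes "x \<le> y"
  shows "ennreal_sqrt x \<le> ennreal_sqrt y"
proof (cases "y = \<top>")
  case False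
  then have "x \<noteq> \<top>"
    using assms by (auto simp: top_unique)
  moreover have "enn2real x \<le> enn2real y"
    using assms False by (simp add: enn2real_mono top.not_eq_extremum)
  ultimately show ?thesis
    using False by (simp add: ennreal_sqrt_def ennreal_leI)
qed (simp add: ennreal_sqrt_def)

lemma ennreal_sqrt_cmult:
  assumes "c \<ge> 0"
  shows "ennreal_sqrt (ennreal (c\<^sup>2) * x) = ennreal c * ennreal_sqrt x"
proof (cases "x = \<top>")
  case True
  then show ?thesis
    using assms by (cases "c = 0") (simp_all add: ennreal_sqrt_def ennreal_mult_top)
next
  case False
  then show ?thesis
    using assms
    by (simp add: ennreal_sqrt_def ennreal_mult_eq_top_iff enn2real_mult real_sqrt_mult ennreal_mult)
qed

text \<open>\<open>I \<noteq> {}\<close> matters for \<open>c = 0\<close>: an empty infimum is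
  \<open>\<top>\<close>, and \<open>0 * \<top> = 0\<close>. This case arises when \<open>X\<close>
  is a single point, where \<open>C1_const\<close> vanishes.\<close>

lemma le_cmult_INF_ennreal:
  fixes a :: ennreal
  assumes "I \<noteq> {}" "c \<ge> 0" and le: "\<And>i. i \<in> I \<Longrightarrow> a \<le> ennreal c * g i"
  shows "a \<le> ennreal c * (INF i\<in>I. g i)"
proof (cases "c = 0")
  case True
  then show ?thesis
    using assms by auto
next
  case False
  then have c: "ennreal (1 / c) * ennreal c = 1"
    using \<open>c \<ge> 0\<close> by (simp flip: ennreal_mult)
  have "ennreal (1 / c) * a \<le> g i" if "i \<in> I" for i
  proof -
    have "ennreal (1 / c) * a \<le> ennreal (1 / c) * (ennreal c * g i)"
      using le[OF that] by (rule mult_left_mono) simp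
    then show ?thesis
      by (simp add: c flip: mult.assoc)
  qed
  then have "ennreal c * (ennreal (1 / c) * a) \<le> ennreal c * (INF i\<in>I. g i)"
    by (intro mult_left_mono INF_greatest) auto
  then show ?thesis
    using c by (simp add: mult.commute[of "ennreal c"] flip: mult.assoc)
qed

text \<open>The image of a coupling under \<open>F\<close> in both components couples the image
  laws, at a cost at most \<open>C\<^sup>2\<close> times the original one. The infimum over all
  couplings is taken afterwards, so no optimal coupling has to exist.\<close>

lemma wasserstein2_Lipschitz:
  assumes F: "F \<in> mspace m \<rightarrow> mspace m'" and "C \<ge> 0"
    and Lip: "\<And>x y. x \<in> mspace m \<Longrightarrow> y \<in> mspace m \<Longrightarrow> mdist m' (F x) (F y) \<le> C * mdist m x y"
    and "couplings m P Q \<noteq> {}"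
  shows "wasserstein2 m' (distr P (metric_borel m') F) (distr Q (metric_borel m') F)
    \<le> ennreal C * wasserstein2 m P Q"
proof -
  let ?P' = "distr P (metric_borel m') F" and ?Q' = "distr Q (metric_borel m') F"
  have "Lipschitz_continuous_map m m' F"
    using F Lip by (auto simp: Lipschitz_continuous_map_def)
  then have Fm: "F \<in> metric_borel m \<rightarrow>\<^sub>M metric_borel m'"
    by (intro continuous_map_measurable Lipschitz_continuous_imp_continuous_map)
  have "(INF \<pi>\<in>couplings m' ?P' ?Q'. \<integral>\<^sup>+ p. ennreal ((mdist m' (fst p) (snd p))\<^sup>2) \<partial>\<pi>)
      \<le> ennreal (C\<^sup>2) * (INF \<pi>\<in>couplings m P Q. \<integral>\<^sup>+ p. ennreal ((mdist m (fst p) (snd p))\<^sup>2) \<partial>\<pi>)"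
  proof (rule le_cmult_INF_ennreal)
    fix \<pi> assume \<pi>: "\<pi> \<in> couplings m P Q"
    let ?B' = "metric_borel m' \<Otimes>\<^sub>M metric_borel m'" and ?G = "\<lambda>p. (F (fst p), F (snd p))"
    have sets: "sets \<pi> = sets (metric_borel m \<Otimes>\<^sub>M metric_borel m)"
      using \<pi> by (simp add: couplings_def)
    have G: "?G \<in> \<pi> \<rightarrow>\<^sub>M ?B'"
      unfolding measurable_cong_sets[OF sets refl] using Fm by measurable
    have "(INF \<pi>\<in>couplings m' ?P' ?Q'. \<integral>\<^sup>+ p. ennreal ((mdist m' (fst p) (snd p))\<^sup>2) \<partial>\<pi>)
        \<le> (\<integral>\<^sup>+ p. ennreal ((mdist m' (fst p) (snd p))\<^sup>2) \<partial>distr \<pi> ?B' ?G)"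
      using couplings_distr[OF \<pi> Fm] by (rule INF_lower)
    also have "\<dots> \<le> ennreal (C\<^sup>2) * (\<integral>\<^sup>+ p. ennreal ((mdist m (fst p) (snd p))\<^sup>2) \<partial>\<pi>)"
    proof (rule nn_integral_distr_le_cmult[OF G])
      fix p assume "p \<in> space \<pi>"
      then have "fst p \<in> mspace m" "snd p \<in> mspace m"
        by (auto simp: sets_eq_imp_space_eq[OF sets] space_pair_measure)
      then have "(mdist m' (F (fst p)) (F (snd p)))\<^sup>2 \<le> (C * mdist m (fst p) (snd p))\<^sup>2"
        by (intro power_mono Lip) auto
      then show "ennreal ((mdist m' (fst (?G p)) (snd (?G p)))\<^sup>2)
          \<le> ennreal (C\<^sup>2) * ennreal ((mdist m (fst p) (snd p))\<^sup>2)"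
        by (simp add: power_mult_distrib ennreal_leI flip: ennreal_mult)
    qed simp
    finally show "(INF \<pi>\<in>couplings m' ?P' ?Q'. \<integral>\<^sup>+ p. ennreal ((mdist m' (fst p) (snd p))\<^sup>2) \<partial>\<pi>)
        \<le> ennreal (C\<^sup>2) * (\<integral>\<^sup>+ p. ennreal ((mdist m (fst p) (snd p))\<^sup>2) \<partial>\<pi>)" .
  qed (use assms in auto)
  from ennreal_sqrt_mono[OF this] show ?thesis
    unfolding wasserstein2_def ennreal_sqrt_cmult[OF \<open>C \<ge> 0\<close>] .
qed

section \<open>Pathwise conditioning as a Lipschitz map\<close>

lemma continuous_square_integrable:
  fixes X :: "'a::euclidean_space set"
  assumes "compact X" "continuous_on X g"
  shows "g \<in> square_integrable (lebesgue_on X)"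
proof -
  interpret finite_measure "lebesgue_on X"
    by (rule finite_measure_lebesgue_on[OF lmeasurable_compact[OF \<open>compact X\<close>]])
  have X: "X \<in> sets lebesgue"
    using lmeasurable_compact[OF \<open>compact X\<close>] by (rule fmeasurableD)
  have g2: "continuous_on X (\<lambda>x. (g x)\<^sup>2)"
    using assms by (intro continuous_intros)
  then obtain B where "\<forall>x\<in>X. norm ((g x)\<^sup>2) \<le> B"
    using compact_imp_bounded[OF compact_continuous_image[OF g2 \<open>compact X\<close>]]
    by (auto simp: bounded_iff)
  then have "integrable (lebesgue_on X) (\<lambda>x. (g x)\<^sup>2)"
    using continuous_imp_measurable_on_sets_lebesgue[OF g2 X]
    by (intro integrable_const_bound[of _ B] AE_I2) auto
  then show ?thesis
    using continuous_imp_measurable_on_sets_lebesgue[OF \<open>continuous_on X g\<close> X]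
    by (simp add: square_integrable_def)
qed

lemma L2_class_cong: "(\<And>x. x \<in> space M \<Longrightarrow> g x = h x) \<Longrightarrow> L2_class M g = L2_class M h"
  by (simp add: L2_class_def cong: AE_cong)

text \<open>The deterministic setting of the update map. Both kernel assumptions concern only the
  sections \<open>k x (xs $ i)\<close>; stationarity yields the bound, sample continuity of the
  process yields continuity.\<close>

locale pathwise_conditioning =
  fixes X :: "(real^'d) set" and k :: "real^'d \<Rightarrow> real^'d \<Rightarrow> real"
    and xs :: "(real^'d)^'n" and y :: "real^'n"
  assumes compact: "compact X" and data: "\<And>i. xs $ i \<in> X"
    and kernel_bound: "\<And>x i. x \<in> X \<Longrightarrow> \<bar>k x (xs $ i)\<bar> \<le> kernel_sup_norm X k"
    and kernel_cont: "\<And>i. continuous_on X (\<lambda>x. k x (xs $ i))"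
begin

lemma nonempty: "X \<noteq> {}"
  using data by auto

definition L2_update :: "(real^'d \<Rightarrow> real) \<Rightarrow> (real^'d \<Rightarrow> real) set" where
  "L2_update g = L2_class (lebesgue_on X) (pathwise_update k xs y g)"

lemma continuous_on_update: "continuous_on X g \<Longrightarrow> continuous_on X (pathwise_update k xs y g)"
  unfolding pathwise_update_def[abs_def] by (intro continuous_intros kernel_cont)

lemma L2_update_mspace: "continuous_on X g \<Longrightarrow> L2_update g \<in> mspace (L2_space X)"
  by (simp add: L2_update_def continuous_square_integrable[OF compact] continuous_on_update)

text \<open>On \<open>X\<close> the update reads the path only at points of \<open>X\<close>, since
  the data lie there. Hence the law on \<open>C_space X\<close> carries enough information.\<close>

lemma L2_update_restrict: "L2_update (restrict g X) = L2_update g"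
  unfolding L2_update_def by (rule L2_class_cong) (simp add: pathwise_update_def data)

text \<open>The update is affine in the path. In the difference of two updates, the kernel row is
  bounded in the supremum norm and the weight vector in the 1-norm.\<close>

lemma update_diff_bound:
  assumes D: "\<And>x. x \<in> X \<Longrightarrow> \<bar>g x - h x\<bar> \<le> D" and "x \<in> X"
  shows "(pathwise_update k xs y g x - pathwise_update k xs y h x)\<^sup>2
    \<le> 2 * (1 + (kernel_sup_norm X k)\<^sup>2 * (opnorm_inf_1 (matrix_inv (kernel_matrix k xs)))\<^sup>2) * D\<^sup>2"
proof -
  define A where "A = matrix_inv (kernel_matrix k xs)"
  define v :: "real^'n" where "v = (\<chi> i. g (xs $ i) - h (xs $ i))"
  define a where "a = (\<chi> i. k x (xs $ i)) \<bullet> (A *v v)"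
  define K where "K = kernel_sup_norm X k"
  have "K \<ge> 0"
    using kernel_bound[OF \<open>x \<in> X\<close>, of undefined] by (simp add: K_def)
  have "\<bar>a\<bar> \<le> (\<Sum>i\<in>UNIV. \<bar>k x (xs $ i) * (A *v v) $ i\<bar>)"
    by (simp add: a_def inner_vec_def sum_abs)
  also have "\<dots> \<le> (\<Sum>i\<in>UNIV. K * \<bar>(A *v v) $ i\<bar>)"
    using kernel_bound[OF \<open>x \<in> X\<close>]
    by (intro sum_mono) (simp add: abs_mult mult_right_mono K_def)
  also have "\<dots> = K * (\<Sum>i\<in>UNIV. \<bar>(A *v v) $ i\<bar>)"
    by (simp add: sum_distrib_left)
  also have "\<dots> \<le> K * (opnorm_inf_1 A * D)"
    using D data \<open>K \<ge> 0\<close> by (intro mult_left_mono opnorm_inf_1_bound) (auto simp: v_def)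
  finally have "\<bar>a\<bar>\<^sup>2 \<le> (K * (opnorm_inf_1 A * D))\<^sup>2"
    by (intro power_mono) auto
  then have a2: "a\<^sup>2 \<le> K\<^sup>2 * (opnorm_inf_1 A)\<^sup>2 * D\<^sup>2"
    by (simp add: power_mult_distrib mult.assoc)
  have d2: "(g x - h x)\<^sup>2 \<le> D\<^sup>2"
    using power_mono[OF D[OF \<open>x \<in> X\<close>], of 2] by simp
  \<comment> \<open>The observations \<open>y\<close> cancel here.\<close>
  have "v = (y - (\<chi> i. h (xs $ i))) - (y - (\<chi> i. g (xs $ i)))"
    by (simp add: v_def vec_eq_iff)
  then have "pathwise_update k xs y g x - pathwise_update k xs y h x = (g x - h x) - a"
    by (simp add: pathwise_update_def a_def A_def matrix_vector_mult_diff_distrib inner_diff_right)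
  moreover have "((g x - h x) - a)\<^sup>2 \<le> 2 * ((g x - h x)\<^sup>2 + a\<^sup>2)"
    using zero_le_power2[of "(g x - h x) + a"] by (simp add: power2_eq_square algebra_simps)
  ultimately have "(pathwise_update k xs y g x - pathwise_update k xs y h x)\<^sup>2 \<le> 2 * (D\<^sup>2 + K\<^sup>2 * (opnorm_inf_1 A)\<^sup>2 * D\<^sup>2)"
    using a2 d2 by simp
  then show ?thesis
    by (simp add: K_def A_def algebra_simps)
qed

lemma C1_const_nonneg: "0 \<le> C1_const X k xs"
  by (simp add: C1_const_def)

lemma C1_const_power2: "(C1_const X k xs)\<^sup>2 = 2 * diameter X ^ CARD('d) *
    (1 + (kernel_sup_norm X k)\<^sup>2 * (opnorm_inf_1 (matrix_inv (kernel_matrix k xs)))\<^sup>2)"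
proof -
  have "0 \<le> diameter X"
    using compact by (simp add: compact_imp_bounded diameter_ge_0)
  then have "(diameter X powr (real CARD('d) / 2))\<^sup>2 = diameter X ^ CARD('d)"
    \<comment> \<open>At diameter 0 both sides vanish, because \<open>0 powr a = 0\<close> and the
      dimension is positive.\<close>
    by (cases "diameter X = 0") (simp_all add: powr_power powr_realpow)
  moreover have "0 \<le> 1 + (kernel_sup_norm X k)\<^sup>2 * (opnorm_inf_1 (matrix_inv (kernel_matrix k xs)))\<^sup>2"
    by simp
  ultimately show ?thesis
    by (simp add: C1_const_def power_mult_distrib)
qed

text \<open>Integrating the pointwise bound over \<open>X\<close> contributes the volume of
  \<open>X\<close>, which the power of the diameter in \<open>C1_const\<close> dominates.\<close>

lemma L2_update_Lipschitz:
  assumes g: "g \<in> mspace (C_space X)" and h: "h \<in> mspace (C_space X)"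
  shows "mdist (L2_space X) (L2_update g) (L2_update h) \<le> C1_const X k xs * mdist (C_space X) g h"
proof -
  define D where "D = mdist (C_space X) g h"
  define c where "c = 1 + (kernel_sup_norm X k)\<^sup>2 * (opnorm_inf_1 (matrix_inv (kernel_matrix k xs)))\<^sup>2"
  let ?G = "pathwise_update k xs y g" and ?H = "pathwise_update k xs y h"
  have X: "X \<in> lmeasurable"
    using compact by (rule lmeasurable_compact)
  interpret finite_measure "lebesgue_on X"
    using X by (rule finite_measure_lebesgue_on)
  have "c \<ge> 0" "D \<ge> 0"
    by (simp_all add: c_def D_def)
  have D: "\<bar>g x - h x\<bar> \<le> D" if "x \<in> X" for x
    using mdist_C_space_le_iff[OF nonempty g h, of D] that by (simp add: D_def)
  have sq: "?G \<in> square_integrable (lebesgue_on X)" "?H \<in> square_integrable (lebesgue_on X)"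
    using g h by (auto simp: mspace_C_space[OF compact]
        intro!: continuous_square_integrable[OF compact] continuous_on_update)
  have "(LINT x|lebesgue_on X. (?G x - ?H x)\<^sup>2) \<le> (LINT x|lebesgue_on X. 2 * c * D\<^sup>2)"
  proof (rule integral_mono)
    show "integrable (lebesgue_on X) (\<lambda>x. (?G x - ?H x)\<^sup>2)"
      using square_integrable_diff[OF sq] by (simp add: square_integrable_def)
    show "(?G x - ?H x)\<^sup>2 \<le> 2 * c * D\<^sup>2" if "x \<in> space (lebesgue_on X)" for x
      unfolding c_def by (rule update_diff_bound[OF D]) (use that in auto)
  qed simp
  also have "\<dots> = measure lebesgue X * (2 * c * D\<^sup>2)"
    using X by (simp add: measure_restrict_space fmeasurableD)
  also have "\<dots> \<le> diameter X ^ CARD('d) * (2 * c * D\<^sup>2)"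
    using measure_le_diameter_power[OF compact nonempty] \<open>c \<ge> 0\<close> by (intro mult_right_mono) auto
  also have "\<dots> = (C1_const X k xs * D)\<^sup>2"
    by (simp add: C1_const_power2 power_mult_distrib c_def mult_ac)
  finally have "sqrt (LINT x|lebesgue_on X. (?G x - ?H x)\<^sup>2) \<le> C1_const X k xs * D"
    using C1_const_nonneg \<open>D \<ge> 0\<close> by (intro real_le_lsqrt) auto
  then show ?thesis
    by (simp add: L2_update_def L2_dist_class[OF sq] D_def)
qed

lemma L2_update_measurable: "L2_update \<in> metric_borel (C_space X) \<rightarrow>\<^sub>M metric_borel (L2_space X)"
proof -
  have "L2_update \<in> mspace (C_space X) \<rightarrow> mspace (L2_space X)"
    using L2_update_mspace by (auto simp: mspace_C_space[OF compact])
  then have "Lipschitz_continuous_map (C_space X) (L2_space X) L2_update"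
    unfolding Lipschitz_continuous_map_def using L2_update_Lipschitz by blast
  then show ?thesis
    by (intro continuous_map_measurable Lipschitz_continuous_imp_continuous_map)
qed

end

section \<open>Laws of processes with continuous paths\<close>

text \<open>Almost surely the modified path agrees with \<open>f \<omega>\<close> on
  \<open>X\<close>, so its evaluations are measurable for the completion, and evaluations
  suffice.\<close>

lemma path_modification_measurable:
  fixes X :: "'a::{metric_space,second_countable_topology} set"
  assumes "compact X" "X \<noteq> {}" and meas: "\<And>x. x \<in> X \<Longrightarrow> (\<lambda>\<omega>. f \<omega> x) \<in> borel_measurable M"
    and cont: "AE \<omega> in M. continuous_on X (f \<omega>)"
  shows "(\<lambda>\<omega>. if restrict (f \<omega>) X \<in> mspace (C_space X) then restrict (f \<omega>) X
      else (SOME e. e \<in> mspace (C_space X))) \<in> completion M \<rightarrow>\<^sub>M metric_borel (C_space X)"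
    (is "?F \<in> _")
proof (rule measurable_C_space[OF assms(1,2)])
  have "restrict (\<lambda>_. 0) X \<in> mspace (C_space X)"
    by (auto simp: mspace_C_space[OF \<open>compact X\<close>] intro!: continuous_on_eq[of X "\<lambda>_. 0"])
  then have "(SOME e. e \<in> mspace (C_space X)) \<in> mspace (C_space X)"
    by (rule someI[where P = "\<lambda>e. e \<in> mspace (C_space X)"])
  then show "?F \<in> space (completion M) \<rightarrow> mspace (C_space X)"
    by simp
  fix x assume "x \<in> X"
  show "(\<lambda>\<omega>. ?F \<omega> x) \<in> borel_measurable (completion M)"
  proof (rule measurable_completion_cong_AE)
    show "(\<lambda>\<omega>. f \<omega> x) \<in> borel_measurable (completion M)"
      using meas[OF \<open>x \<in> X\<close>] by (rule measurable_completion)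
    show "AE \<omega> in M. f \<omega> x = ?F \<omega> x"
      using cont
    proof eventually_elim
      fix \<omega> assume "continuous_on X (f \<omega>)"
      then have "restrict (f \<omega>) X \<in> mspace (C_space X)"
        by (auto simp: mspace_C_space[OF \<open>compact X\<close>] intro: continuous_on_eq)
      then show "f \<omega> x = ?F \<omega> x"
        using \<open>x \<in> X\<close> by simp
    qed
  qed simp
qed

lemma prob_space_C_law:
  fixes X :: "'a::{metric_space,second_countable_topology} set"
  assumes "compact X" "X \<noteq> {}" "prob_space M"
    and "\<And>x. x \<in> X \<Longrightarrow> (\<lambda>\<omega>. f \<omega> x) \<in> borel_measurable M"
    and "AE \<omega> in M. continuous_on X (f \<omega>)"
  shows "prob_space (C_law M X f)"
  unfolding C_law_def path_law_def
  using assms by (intro prob_space.prob_space_distr prob_space.prob_space_completion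
      path_modification_measurable)

text \<open>Conditioning commutes with taking laws. The arbitrary replacement points in the two
  spaces need not correspond under \<open>L2_update\<close>, but they are used only on a null
  set.\<close>

lemma (in pathwise_conditioning) L2_law_conditioned:
  assumes meas: "\<And>x. x \<in> X \<Longrightarrow> (\<lambda>\<omega>. f \<omega> x) \<in> borel_measurable M"
    and cont: "AE \<omega> in M. continuous_on X (f \<omega>)"
  shows "L2_law M X (conditioned k xs y f) = distr (C_law M X f) (metric_borel (L2_space X)) L2_update"
proof -
  define F where "F \<omega> = (if restrict (f \<omega>) X \<in> mspace (C_space X) then restrict (f \<omega>) X
    else (SOME e. e \<in> mspace (C_space X)))" for \<omega>
  define G where "G \<omega> = (if L2_update (f \<omega>) \<in> mspace (L2_space X) then L2_update (f \<omega>)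
    else (SOME e. e \<in> mspace (L2_space X)))" for \<omega>
  have F: "F \<in> completion M \<rightarrow>\<^sub>M metric_borel (C_space X)"
    using path_modification_measurable[OF compact nonempty meas cont] by (simp add: F_def[abs_def])
  then have TF: "L2_update \<circ> F \<in> completion M \<rightarrow>\<^sub>M metric_borel (L2_space X)"
    using L2_update_measurable by (rule measurable_comp)
  have ae: "AE \<omega> in M. (L2_update \<circ> F) \<omega> = G \<omega>"
    using cont
  proof eventually_elim
    fix \<omega> assume \<omega>: "continuous_on X (f \<omega>)"
    then have "restrict (f \<omega>) X \<in> mspace (C_space X)"
      by (auto simp: mspace_C_space[OF compact] intro: continuous_on_eq)
    then show "(L2_update \<circ> F) \<omega> = G \<omega>"
      using L2_update_mspace[OF \<omega>] by (simp add: F_def G_def L2_update_restrict)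
  qed
  \<comment> \<open>The zero path shows that the space has a point, so that \<open>SOME\<close>
    selects one.\<close>
  have "L2_update (\<lambda>_. 0) \<in> mspace (L2_space X)"
    by (rule L2_update_mspace) simp
  then have "(SOME e. e \<in> mspace (L2_space X)) \<in> mspace (L2_space X)"
    by (rule someI)
  then have "G \<in> space M \<rightarrow> space (metric_borel (L2_space X))"
    by (simp add: G_def del: mspace_L2_metric)
  with TF ae have G: "G \<in> completion M \<rightarrow>\<^sub>M metric_borel (L2_space X)"
    by (rule measurable_completion_cong_AE)
  have "distr (C_law M X f) (metric_borel (L2_space X)) L2_update =
      distr (completion M) (metric_borel (L2_space X)) (L2_update \<circ> F)"
    using distr_distr[OF L2_update_measurable F]
    by (simp add: C_law_def path_law_def F_def[abs_def])
  also have "\<dots> = distr (completion M) (metric_borel (L2_space X)) G"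
    using ae TF G by (intro distr_cong_AE AE_completion) auto
  also have "\<dots> = L2_law M X (conditioned k xs y f)"
    unfolding L2_law_def path_law_def conditioned_def G_def[abs_def] L2_update_def ..
  finally show ?thesis ..
qed

lemma basis_prior_measurable:
  assumes "gaussian_vector N w m \<Sigma>"
  shows "(\<lambda>\<omega>. basis_prior \<phi> w \<omega> x) \<in> borel_measurable N"
proof -
  have [measurable]: "(\<lambda>\<omega>. w \<omega> $ i) \<in> borel_measurable N" for i
    using assms by (simp add: gaussian_vector_def jointly_normal_def)
  show ?thesis
    unfolding basis_prior_def by measurable
qed

theorem proposition5:
  fixes X :: "(real^'d) set"
    and k :: "real^'d \<Rightarrow> real^'d \<Rightarrow> real"
    and \<mu> :: "real^'d \<Rightarrow> real"
    and M :: "'w measure" and f :: "'w \<Rightarrow> real^'d \<Rightarrow> real"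
    and N :: "'v measure" and w :: "'v \<Rightarrow> real^'l" and \<Sigma>\<^sub>w :: "real^'l^'l"
    and \<phi> :: "'l \<Rightarrow> real^'d \<Rightarrow> real"
    and xs :: "(real^'d)^'n" and y :: "real^'n"
  assumes "compact X"
    and "kernel_on X k" and "stationary_on X k"
    and "prob_space M" and "gaussian_process M X f \<mu> k"
    and "AE \<omega> in M. continuous_on X (f \<omega>)"
    and "\<And>i. continuous_on X (\<phi> i)"
    and "prob_space N" and "gaussian_vector N w 0 \<Sigma>\<^sub>w"
    and "\<And>i. xs $ i \<in> X" and "invertible (kernel_matrix k xs)"
  shows "wasserstein2 (L2_space X)
           (L2_law N X (conditioned k xs y (basis_prior \<phi> w)))
           (L2_law M X (conditioned k xs y f))
         \<le> ennreal (C1_const X k xs) *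
           wasserstein2 (C_space X) (C_law N X (basis_prior \<phi> w)) (C_law M X f)"
proof -
  interpret pathwise_conditioning X k xs y
  proof
    show "\<bar>k x (xs $ i)\<bar> \<le> kernel_sup_norm X k" if "x \<in> X" for x i
      using kernel_le_sup_norm[OF assms(2,3) that assms(10)] .
    show "continuous_on X (\<lambda>x. k x (xs $ i))" for i
      using continuous_on_gaussian_kernel[OF assms(4,5,2,6,10)] .
  qed (use assms in auto)
  note f_meas = gaussian_process_measurable[OF assms(5)]
  have prior_cont: "continuous_on X (basis_prior \<phi> w \<omega>)" for \<omega>
    unfolding basis_prior_def[abs_def] by (intro continuous_intros assms(7))
  note prior_meas = basis_prior_measurable[OF assms(9)]
  have "prob_space (C_law M X f)"
    by (rule prob_space_C_law[OF compact nonempty assms(4) f_meas assms(6)])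
  moreover have "prob_space (C_law N X (basis_prior \<phi> w))"
    by (rule prob_space_C_law[OF compact nonempty assms(8) prior_meas]) (simp add: prior_cont)
  \<comment> \<open>Both path laws are probability measures on the Borel sets of
    \<open>C_space X\<close>, so their product is available as a coupling.\<close>
  ultimately have "couplings (C_space X) (C_law N X (basis_prior \<phi> w)) (C_law M X f) \<noteq> {}"
    by (intro couplings_nonempty) (simp_all add: C_law_def path_law_def)
  moreover have "L2_update \<in> mspace (C_space X) \<rightarrow> mspace (L2_space X)"
    using L2_update_mspace by (auto simp: mspace_C_space[OF compact])
  ultimately have "wasserstein2 (L2_space X)
      (distr (C_law N X (basis_prior \<phi> w)) (metric_borel (L2_space X)) L2_update)
      (distr (C_law M X f) (metric_borel (L2_space X)) L2_update)
    \<le> ennreal (C1_const X k xs) *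
      wasserstein2 (C_space X) (C_law N X (basis_prior \<phi> w)) (C_law M X f)"
    by (intro wasserstein2_Lipschitz C1_const_nonneg L2_update_Lipschitz)
  moreover have "L2_law M X (conditioned k xs y f) =
      distr (C_law M X f) (metric_borel (L2_space X)) L2_update"
    by (rule L2_law_conditioned[OF f_meas assms(6)])
  moreover have "L2_law N X (conditioned k xs y (basis_prior \<phi> w)) =
      distr (C_law N X (basis_prior \<phi> w)) (metric_borel (L2_space X)) L2_update"
    by (rule L2_law_conditioned[OF prior_meas]) (simp add: prior_cont)
  ultimately show ?thesis
    by simp
qed

end
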